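(* There is a Karp reduction of the graph isomorphism problem to the unimodular isomorphism problem (that is, the unimodular isomorphism problem of convex lattice polytopes is graph isomorphism hard).
   Context: A convex lattice polytope in $\mathbb{R}^n$ is the convex hull of a finite subset of $\mathbb{Z}^n$. Unimodular isomorphism problem (UIP): given $n$-dimensional convex lattice polytopes $P,P'\subset\mathbb{R}^n$ (all vertices in $\mathbb{Z}^n$), decide whether there exist a unimodular matrix $U\in GL_n(\mathbb{Z})$ and an integer vector $\mathbf{Z}\in\mathbb{Z}^n$ such that $P'=UP+\mathbf{Z}$. Algorithmically, a polytope $P$ with $d$ vertices is given by an $n\times d$ vertex matrix $V_P\in\mathbb{Z}^{n\times d}$ whose columns are the vertices of $P$ (in some order); equivalently, given $V_P,V_{P'}\in\mathbb{Z}^{n\times d}$, decide whether there exist $U\in GL_n(\mathbb{Z})$, $\mathbf{Z}\in\mathbb{Z}^n$ and a $d\times d$ permutation matrix $M$ such that $V_{P'}=UV_PM+\mathbf{Z}$, where adding a vector to a matrix means adding it to every column. Graph isomorphism problem (GIP): given two graphs $G$ and $G'$, decide whether there is a bijection $\varphi$ between their node sets such that $\{\varphi(v),\varphi(w)\}$ is an edge of $G'$ if and only if $\{v,w\}$ is an edge of $G$. A decision problem $C$ is Karp reducible to a decision problem $D$ if there is a polynomial time algorithm which constructs from an instance $I$ of $C$ an instance $J$ of $D$ such that the answer for $J$ is "yes" if and only if the answer for $I$ is "yes". A decision problem is graph isomorphism hard if GIP is Karp reducible to it. *)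

theory Defs
  imports "Jordan_Normal_Form.DL_Rank" "HOL-Computational_Algebra.Polynomial" Complex_Main
begin

section \<open>Polynomial-time computation\<close>

text \<open>Deterministic multi-tape Turing machines. Symbols are natural numbers with 0 the blank; the
  tapes are infinite in both directions. A machine is a list of commands: the state \<open>q\<close> is an
  index into that list, the initial state is 0, and any state \<open>q \<ge> length M\<close> is halting. A command
  maps the symbols under the heads to the next state and to one action per tape.\<close>

datatype move = GoLeft | Stay | GoRight

type_synonym command = "nat list \<Rightarrow> nat \<times> (nat \<times> move) list"
type_synonym machine = "command list"
type_synonym tape = "(int \<Rightarrow> nat) \<times> int"
type_synonym config = "nat \<times> tape list"

text \<open>\<open>k\<close> tapes and tape alphabet \<open>{0..<g}\<close>, which contains the blank and the two bits.
  Commands are arbitrary outside these bounds, where they are never executed.\<close>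

definition turing_machine :: "nat \<Rightarrow> nat \<Rightarrow> machine \<Rightarrow> bool" where
  "turing_machine k g M \<longleftrightarrow> 2 \<le> k \<and> 3 \<le> g \<and>
     (\<forall>c\<in>set M. \<forall>ss. length ss = k \<longrightarrow> set ss \<subseteq> {0..<g} \<longrightarrow>
        (case c ss of (q, as) \<Rightarrow>
           q \<le> length M \<and> length as = k \<and> fst ` set as \<subseteq> {0..<g}))"

fun head_symbol :: "tape \<Rightarrow> nat" where
  "head_symbol (c, h) = c h"

fun act :: "nat \<times> move \<Rightarrow> tape \<Rightarrow> tape" where
  "act (s, m) (c, h) =
     (c(h := s), case m of GoLeft \<Rightarrow> h - 1 | Stay \<Rightarrow> h | GoRight \<Rightarrow> h + 1)"

fun step :: "machine \<Rightarrow> config \<Rightarrow> config" where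
  "step M (q, ts) =
     (if q < length M
      then case (M ! q) (map head_symbol ts) of (q', as) \<Rightarrow> (q', map2 act as ts)
      else (q, ts))"

definition string_contents :: "bool list \<Rightarrow> int \<Rightarrow> nat" where
  "string_contents xs = (\<lambda>i. if 0 \<le> i \<and> i < int (length xs)
     then if xs ! nat i then 2 else 1
     else 0)"

definition initial_config :: "nat \<Rightarrow> bool list \<Rightarrow> config" where
  "initial_config k xs = (0, (string_contents xs, 0) # replicate (k - 1) (\<lambda>_. 0, 0))"

text \<open>Input on tape 0, output on tape 1. As \<open>step\<close> does not change a halted configuration, the
  following says that the machine halts after at most \<open>t\<close> steps.\<close>

definition computes_within :: "nat \<Rightarrow> machine \<Rightarrow> nat \<Rightarrow> bool list \<Rightarrow> bool list \<Rightarrow> bool" where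
  "computes_within k M t xs ys \<longleftrightarrow>
     (case (step M ^^ t) (initial_config k xs) of (q, ts) \<Rightarrow>
        length M \<le> q \<and> fst (ts ! 1) = string_contents ys)"


section \<open>Decision problems and Karp reductions\<close>

record 'a decision_problem =
  instances :: "'a set"
  answer_yes :: "'a \<Rightarrow> bool"
  encode :: "'a \<Rightarrow> bool list"

definition karp_reducible :: "'a decision_problem \<Rightarrow> 'b decision_problem \<Rightarrow> bool" where
  "karp_reducible C D \<longleftrightarrow>
     (\<exists>k g M (p :: nat poly). turing_machine k g M \<and>
        (\<forall>I\<in>instances C. \<exists>J\<in>instances D.
           computes_within k M (poly p (length (encode C I))) (encode C I) (encode D J) \<and>
           (answer_yes D J \<longleftrightarrow> answer_yes C I)))"

text \<open>Size parameters are written in unary, which is polynomially equivalent to binary here since the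
  data that follow have at least that order of size. Matrix entries are written in binary: a sign bit
  and then the binary digits of the absolute value, least significant first, each preceded by
  \<open>True\<close>, with a final \<open>False\<close>.\<close>

definition encode_unary :: "nat \<Rightarrow> bool list" where
  "encode_unary n = replicate n True @ [False]"

fun encode_nat :: "nat \<Rightarrow> bool list" where
  "encode_nat n = (if n = 0 then [False] else True # odd n # encode_nat (n div 2))"

declare encode_nat.simps [simp del]

definition encode_int :: "int \<Rightarrow> bool list" where
  "encode_int z = (z < 0) # encode_nat (nat \<bar>z\<bar>)"


section \<open>The graph isomorphism problem\<close>

text \<open>A finite simple graph \<open>(m, E)\<close> has the nodes \<open>0, \<dots>, m - 1\<close> and the edge set \<open>E\<close>; it is encoded
  by its number of nodes and its adjacency matrix.\<close>

type_synonym graph = "nat \<times> nat set set"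

definition nodes :: "graph \<Rightarrow> nat set" where
  "nodes G = {..<fst G}"

definition edges :: "graph \<Rightarrow> nat set set" where
  "edges G = snd G"

definition simple_graph :: "graph \<Rightarrow> bool" where
  "simple_graph G \<longleftrightarrow> edges G \<subseteq> {{v, w} | v w. v \<in> nodes G \<and> w \<in> nodes G \<and> v \<noteq> w}"

definition graph_isomorphic :: "graph \<Rightarrow> graph \<Rightarrow> bool" where
  "graph_isomorphic G G' \<longleftrightarrow>
     (\<exists>\<phi>. bij_betw \<phi> (nodes G) (nodes G') \<and>
        (\<forall>v\<in>nodes G. \<forall>w\<in>nodes G. {\<phi> v, \<phi> w} \<in> edges G' \<longleftrightarrow> {v, w} \<in> edges G))"

definition encode_graph :: "graph \<Rightarrow> bool list" where
  "encode_graph G = encode_unary (fst G) @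
     [{v, w} \<in> edges G. v \<leftarrow> [0..<fst G], w \<leftarrow> [0..<fst G]]"

definition GIP :: "(graph \<times> graph) decision_problem" where
  "GIP = \<lparr>
     instances = {(G, G'). simple_graph G \<and> simple_graph G'},
     answer_yes = (\<lambda>(G, G'). graph_isomorphic G G'),
     encode = (\<lambda>(G, G'). encode_graph G @ encode_graph G')\<rparr>"


section \<open>The unimodular isomorphism problem\<close>

text \<open>The convex hull in \<open>\<real>\<^sup>n\<close> of the columns of an \<open>n \<times> d\<close> integer matrix.\<close>

definition polytope_of :: "int mat \<Rightarrow> real vec set" where
  "polytope_of V = {map_mat real_of_int V *\<^sub>v l | l. l \<in> carrier_vec (dim_col V) \<and>
     (\<forall>j<dim_col V. 0 \<le> l $ j) \<and> (\<Sum>j<dim_col V. l $ j) = 1}"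

definition vertices :: "real vec set \<Rightarrow> real vec set" where
  "vertices P = {v\<in>P. \<forall>x\<in>P. \<forall>y\<in>P. \<forall>t::real. 0 < t \<and> t < 1 \<and> v = t \<cdot>\<^sub>v x + (1 - t) \<cdot>\<^sub>v y
     \<longrightarrow> x = v \<and> y = v}"

text \<open>The dimension of the affine hull of a nonempty set, i.e. of the linear span of its differences.\<close>

definition (in vec_space) affine_dim :: "'a vec set \<Rightarrow> nat" where
  "affine_dim P = vectorspace.dim class_ring (span_vs {x - y | x y. x \<in> P \<and> y \<in> P})"

text \<open>The columns of \<open>V\<close> are, without repetition, the vertices of a full-dimensional polytope.\<close>

definition vertex_matrix :: "int mat \<Rightarrow> bool" where
  "vertex_matrix V \<longleftrightarrow>
     polytope_of V \<noteq> {} \<and>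
     vec_space.affine_dim (dim_row V) (polytope_of V) = dim_row V \<and>
     distinct (cols V) \<and>
     map_vec real_of_int ` set (cols V) = vertices (polytope_of V)"

text \<open>\<open>invertible_mat U\<close> for an integer matrix \<open>U\<close> asks for an integer inverse, so it is membership
  in \<open>GL\<^sub>n(\<int>)\<close>.\<close>

definition unimodular_isomorphic :: "nat \<Rightarrow> real vec set \<Rightarrow> real vec set \<Rightarrow> bool" where
  "unimodular_isomorphic n P P' \<longleftrightarrow>
     (\<exists>U\<in>carrier_mat n n. \<exists>z\<in>carrier_vec n. invertible_mat (U :: int mat) \<and>
        P' = (\<lambda>x. map_mat real_of_int U *\<^sub>v x + map_vec real_of_int z) ` P)"

definition encode_mat :: "int mat \<Rightarrow> bool list" where
  "encode_mat V = encode_unary (dim_row V) @ encode_unary (dim_col V) @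
     concat [encode_int (V $$ (i, j)). j \<leftarrow> [0..<dim_col V], i \<leftarrow> [0..<dim_row V]]"

text \<open>The two polytopes lie in the same \<open>\<real>\<^sup>n\<close>, but may have different numbers of vertices.\<close>

definition UIP :: "(int mat \<times> int mat) decision_problem" where
  "UIP = \<lparr>
     instances = {(V, V'). dim_row V = dim_row V' \<and> vertex_matrix V \<and> vertex_matrix V'},
     answer_yes = (\<lambda>(V, V').
       unimodular_isomorphic (dim_row V) (polytope_of V) (polytope_of V')),
     encode = (\<lambda>(V, V'). encode_mat V @ encode_mat V')\<rparr>"


section \<open>The encodings are injective\<close>

lemma encode_unary_append_eq:
  "encode_unary m @ u = encode_unary n @ v \<Longrightarrow> m = n \<and> u = v"
  unfolding encode_unary_def
proof (induction m arbitrary: n)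
  case 0
  then show ?case by (cases n) simp_all
next
  case (Suc m)
  then show ?case by (cases n) simp_all
qed

lemma encode_nat_0: "encode_nat 0 = [False]"
  by (subst encode_nat.simps) simp

lemma encode_nat_pos: "0 < n \<Longrightarrow> encode_nat n = True # odd n # encode_nat (n div 2)"
  by (subst encode_nat.simps) simp

lemma encode_nat_append_eq:
  "encode_nat m @ u = encode_nat n @ v \<Longrightarrow> m = n \<and> u = v"
proof (induction m arbitrary: n rule: less_induct)
  case (less m)
  consider "m = 0" | "n = 0" | "0 < m" "0 < n" by blast
  then show ?case
  proof cases
    case 1
    then have "n = 0"
      using less.prems encode_nat_pos[of n] by (cases "n = 0") (simp_all add: encode_nat_0)
    with 1 less.prems show ?thesis by simp
  next
    case 2
    then have "m = 0"
      using less.prems encode_nat_pos[of m] by (cases "m = 0") (simp_all add: encode_nat_0)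
    with 2 less.prems show ?thesis by simp
  next
    case 3
    have "odd m = odd n" and eq: "encode_nat (m div 2) @ u = encode_nat (n div 2) @ v"
      using less.prems by (simp_all add: encode_nat_pos[OF 3(1)] encode_nat_pos[OF 3(2)])
    have "m div 2 < m" using 3 by simp
    note less.IH[OF this eq]
    moreover have "m mod 2 = n mod 2"
      using \<open>odd m = odd n\<close> by (simp add: mod2_eq_if)
    ultimately show ?thesis
      by (metis div_mult_mod_eq)
  qed
qed

lemma encode_int_append_eq:
  assumes "encode_int a @ u = encode_int b @ v"
  shows "a = b \<and> u = v"
proof -
  from assms have sign: "(a < 0) = (b < 0)"
    and eq: "encode_nat (nat \<bar>a\<bar>) @ u = encode_nat (nat \<bar>b\<bar>) @ v"
    by (simp_all add: encode_int_def)
  have "nat \<bar>a\<bar> = nat \<bar>b\<bar>" "u = v"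
    using encode_nat_append_eq[OF eq] by simp_all
  with sign show ?thesis by linarith
qed

lemma concat_encode_int_append_eq:
  "concat (map (\<lambda>x. encode_int (f x)) xs) @ u = concat (map (\<lambda>x. encode_int (g x)) xs) @ v \<Longrightarrow>
    (\<forall>x\<in>set xs. f x = g x) \<and> u = v"
proof (induction xs)
  case Nil
  then show ?case by simp
next
  case (Cons x xs)
  from Cons.prems have
    "encode_int (f x) @ (concat (map (\<lambda>x. encode_int (f x)) xs) @ u)
      = encode_int (g x) @ (concat (map (\<lambda>x. encode_int (g x)) xs) @ v)"
    by simp
  note eqs = encode_int_append_eq[OF this]
  with Cons.IH have "(\<forall>x\<in>set xs. f x = g x) \<and> u = v" by blast
  with eqs show ?case by simp
qed

lemma encode_mat_append_eq:
  assumes "encode_mat V @ u = encode_mat W @ v"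
  shows "V = W \<and> u = v"
proof -
  define ix where "ix = List.product [0..<dim_col V] [0..<dim_row V]"
  have *: "concat [encode_int (A $$ (i, j)). j \<leftarrow> js, i \<leftarrow> is]
      = concat (map (\<lambda>x. encode_int (A $$ (snd x, fst x))) (List.product js is))" for A js "is"
    by (induction js) (auto simp: comp_def)
  define rest where "rest A = concat [encode_int (A $$ (i, j)). j \<leftarrow> [0..<dim_col A], i \<leftarrow> [0..<dim_row A]]"
    for A :: "int mat"
  have enc: "encode_mat A = encode_unary (dim_row A) @ encode_unary (dim_col A) @ rest A" for A
    by (simp only: encode_mat_def rest_def)
  have "encode_unary (dim_row V) @ (encode_unary (dim_col V) @ rest V @ u)
      = encode_unary (dim_row W) @ (encode_unary (dim_col W) @ rest W @ v)"
    using assms by (simp only: enc append_assoc)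
  note rows = encode_unary_append_eq[OF this]
  note cols = encode_unary_append_eq[OF conjunct2[OF rows]]
  from rows cols have dims: "dim_row V = dim_row W" "dim_col V = dim_col W" and "rest V @ u = rest W @ v"
    by blast+
  then have "concat (map (\<lambda>x. encode_int (V $$ (snd x, fst x))) ix) @ u
      = concat (map (\<lambda>x. encode_int (W $$ (snd x, fst x))) ix) @ v"
    by (simp only: rest_def ix_def *)
  from concat_encode_int_append_eq[OF this]
  have "(\<forall>x\<in>set ix. V $$ (snd x, fst x) = W $$ (snd x, fst x)) \<and> u = v" .
  with dims show ?thesis
    by (auto simp: ix_def)
qed

lemma encode_graph_append_eq:
  assumes "simple_graph G" "simple_graph H" "encode_graph G @ u = encode_graph H @ v"
  shows "G = H \<and> u = v"
proof -
  have *: "[{v, w} \<in> E. v \<leftarrow> vs, w \<leftarrow> ws] = map (\<lambda>x. {fst x, snd x} \<in> E) (List.product vs ws)"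
    for E and vs ws :: "nat list"
    by (induction vs) (auto simp: comp_def)
  define adjs where "adjs K = [{v, w} \<in> edges K. v \<leftarrow> [0..<fst K], w \<leftarrow> [0..<fst K]]" for K :: graph
  have "encode_unary (fst G) @ (adjs G @ u) = encode_unary (fst H) @ (adjs H @ v)"
    using assms(3) by (simp only: encode_graph_def adjs_def append_assoc)
  note eqs = encode_unary_append_eq[OF this]
  then have m: "fst G = fst H" by blast
  have "length (adjs G) = length (adjs H)"
    unfolding adjs_def * by (simp add: m)
  with eqs have "adjs G = adjs H" "u = v" by simp_all
  then have adj: "\<forall>x<fst G. \<forall>y<fst G. {x, y} \<in> edges G \<longleftrightarrow> {x, y} \<in> edges H"
    unfolding adjs_def * by (auto simp: m)
  have "edges G \<subseteq> edges H"
    using assms(1) adj unfolding simple_graph_def nodes_def by blast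
  moreover have "edges H \<subseteq> edges G"
    using assms(2) adj unfolding simple_graph_def nodes_def m[symmetric] by blast
  ultimately have "edges G = edges H"
    by blast
  with m \<open>u = v\<close> show ?thesis by (simp add: edges_def prod_eq_iff)
qed

lemma inj_on_encode_GIP: "inj_on (encode GIP) (instances GIP)"
proof (rule inj_onI, clarify)
  fix G G' H H'
  assume "(G, G') \<in> instances GIP" "(H, H') \<in> instances GIP"
    and "encode GIP (G, G') = encode GIP (H, H')"
  then have "simple_graph G" "simple_graph G'" "simple_graph H" "simple_graph H'"
    and eq: "encode_graph G @ encode_graph G' = encode_graph H @ encode_graph H'"
    by (simp_all add: GIP_def)
  moreover from this have "G = H" "encode_graph G' @ [] = encode_graph H' @ []"
    using encode_graph_append_eq[OF _ _ eq] by simp_all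
  ultimately show "G = H \<and> G' = H'"
    using encode_graph_append_eq by blast
qed

lemma inj_on_encode_UIP: "inj_on (encode UIP) (instances UIP)"
proof (rule inj_onI, clarify)
  fix V V' W W'
  assume "encode UIP (V, V') = encode UIP (W, W')"
  then have "encode_mat V @ encode_mat V' = encode_mat W @ encode_mat W'"
    by (simp add: UIP_def)
  then have "V = W" "encode_mat V' @ [] = encode_mat W' @ []"
    using encode_mat_append_eq by force+
  then show "V = W \<and> V' = W'"
    using encode_mat_append_eq by blast
qed

end

theory Submission
  imports Defs
begin

text \<open>
  A simple graph on \<open>m\<close> nodes is turned into a polytope in \<open>\<real>\<^bsup>3m\<^esup>\<close> whose vertices are the origin, the
  unit vectors and the indicator vectors of the hyperedges of a hypergraph on the \<open>3m\<close> coordinates.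
  Points with coordinates 0 and 1 are always vertices of their convex hull, so such polytopes are
  easy to write down, and a unimodular isomorphism \<open>x \<mapsto> U x + z\<close> amounts to a bijection between the
  two sets of 0/1 vectors.

  Every permutation of the coordinates that is an isomorphism of hypergraphs gives a unimodular
  isomorphism. The converse (\<open>unimodular_isomorphic_hypergraphD\<close>) needs a way to recognise the
  origin, and congruences provide it. Let \<open>k \<ge> 2\<close> be such that each coordinate is 1 in a multiple of
  \<open>k\<close> vertices, whereas the number \<open>N\<close> of vertices is coprime to \<open>k\<close>. Summing over all vertices
  shows that \<open>N z\<close> vanishes modulo \<open>k\<close>, hence so does \<open>z\<close>; as the image of the origin, \<open>z\<close> is
  itself a 0/1 vector, and therefore \<open>z = 0\<close>. Now \<open>U\<close> and its inverse both map unit vectors to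
  nonzero vectors with entries 0 and 1, which makes \<open>U\<close> a permutation matrix.

  The hypergraph of a graph has three coordinates \<open>(0, v)\<close>, \<open>(1, v)\<close>, \<open>(2, v)\<close> and three hyperedges
  for each node \<open>v\<close>: the hyperedge \<open>(v, c)\<close> consists of the \<open>(0, w)\<close> with \<open>w\<close> adjacent to \<open>v\<close> and
  of the two coordinates \<open>(b, v)\<close> with \<open>b \<noteq> c\<close>. A coordinate \<open>(0, v)\<close> lies in \<open>3 deg v + 2\<close> of them
  and the other coordinates in exactly 2, so that together with the unit vector each coordinate is 1
  in a multiple of 3 vertices, and there are \<open>6m + 1\<close> vertices: the criterion applies with \<open>k = 3\<close>.
  The graph can be read off from the hypergraph without knowing the names of the coordinates
  (\<open>graph_isomorphic_incidence\<close>). Coordinates of degree 2 only join hyperedges of one node, which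
  recovers the three hyperedges of a node as a class; and \<open>v\<close> is adjacent to \<open>w\<close> iff some
  coordinate lies in some but not all hyperedges of \<open>v\<close>, and in all hyperedges of \<open>w\<close>.

  In the vertex matrix, a column is a concatenation of three blocks of length \<open>m\<close>, and the entry of a
  block at \<open>w\<close> is a Boolean function of the adjacency of \<open>v\<close> and \<open>w\<close> and of the truth value of
  \<open>v = w\<close>. The entries are thus written while scanning row \<open>v\<close> of the adjacency matrix in parallel
  with a tape that marks position \<open>v\<close>. The machine doing this is compiled from a program in a small
  language of while programs, whose big-step rules count the steps. Two graphs with different
  numbers of nodes are never isomorphic; for these the program writes a fixed pair of
  polytopes that are not isomorphic, a triangle and a square.
\<close>

section \<open>Polytopes with 0/1 vertices\<close>

lemma real_mult_mat_vec_nth: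
  assumes "i < dim_row V" "l \<in> carrier_vec (dim_col V)"
  shows "(map_mat real_of_int V *\<^sub>v l) $ i = (\<Sum>j<dim_col V. real_of_int (V $$ (i, j)) * l $ j)"
  using assms by (simp add: scalar_prod_def row_def atLeast0LessThan)

text \<open>The standard simplex: the coefficient vectors of convex combinations.\<close>

definition weights :: "nat \<Rightarrow> real vec set" where
  "weights d = {l \<in> carrier_vec d. (\<forall>j<d. 0 \<le> l $ j) \<and> (\<Sum>j<d. l $ j) = 1}"

lemma polytope_of_eq: "polytope_of V = (\<lambda>l. map_mat real_of_int V *\<^sub>v l) ` weights (dim_col V)"
  by (auto simp: polytope_of_def weights_def)

lemma polytope_of_carrier: "polytope_of V \<subseteq> carrier_vec (dim_row V)"
  by (auto simp: polytope_of_eq weights_def intro!: carrier_vecI)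

lemma unit_vec_weights: "j < d \<Longrightarrow> unit_vec d j \<in> weights d"
proof -
  assume j: "j < d"
  have "(\<Sum>k<d. unit_vec d j $ k) = (\<Sum>k<d. if k = j then 1 else 0 :: real)"
    by (intro sum.cong) (use j in auto)
  then show ?thesis using j by (auto simp: weights_def)
qed

lemma mult_unit_vec:
  assumes "j < dim_col V"
  shows "map_mat real_of_int V *\<^sub>v unit_vec (dim_col V) j = map_vec real_of_int (col V j)"
proof (rule eq_vecI)
  fix i assume "i < dim_vec (map_vec real_of_int (col V j))"
  then have i: "i < dim_row V" by simp
  have "(\<Sum>k<dim_col V. real_of_int (V $$ (i, k)) * unit_vec (dim_col V) j $ k)
      = (\<Sum>k<dim_col V. if k = j then real_of_int (V $$ (i, k)) else 0)"
    by (intro sum.cong) (use assms in auto)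
  then show "(map_mat real_of_int V *\<^sub>v unit_vec (dim_col V) j) $ i = map_vec real_of_int (col V j) $ i"
    using assms i real_mult_mat_vec_nth[OF i, of "unit_vec (dim_col V) j"] by simp
qed simp

lemma column_in_polytope: "c \<in> set (cols V) \<Longrightarrow> map_vec real_of_int c \<in> polytope_of V"
proof -
  assume "c \<in> set (cols V)"
  then obtain j where j: "j < dim_col V" "c = col V j" by (auto simp: cols_def)
  then show ?thesis
    unfolding polytope_of_eq by (intro image_eqI[OF _ unit_vec_weights[OF j(1)]]) (simp add: mult_unit_vec)
qed

text \<open>If a point of the hull gives a column \<open>c\<close> a weight strictly between 0 and 1, then it lies strictly
  between \<open>c\<close> and the point with the remaining weights rescaled; a vertex must then coincide with \<open>c\<close>.\<close>

lemma vertices_subset_columns: "vertices (polytope_of V) \<subseteq> map_vec real_of_int ` set (cols V)"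
proof
  let ?A = "map_mat real_of_int V" and ?d = "dim_col V"
  fix v assume v: "v \<in> vertices (polytope_of V)"
  then obtain l where l: "l \<in> weights ?d" and vl: "v = ?A *\<^sub>v l"
    by (auto simp: vertices_def polytope_of_eq)
  then have lc: "l \<in> carrier_vec ?d" and pos: "\<And>j. j < ?d \<Longrightarrow> 0 \<le> l $ j" and sum: "(\<Sum>j<?d. l $ j) = 1"
    by (auto simp: weights_def)
  from sum have "\<exists>j<?d. l $ j \<noteq> 0"
    by (metis (no_types, lifting) lessThan_iff sum.neutral zero_neq_one)
  then obtain j where j: "j < ?d" and lj: "0 < l $ j" using pos by (metis order_le_less)
  have rest: "(\<Sum>k\<in>{..<?d} - {j}. l $ k) = 1 - l $ j"
    using sum.remove[of "{..<?d}" j "\<lambda>k. l $ k"] j sum by simp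
  let ?c = "map_vec real_of_int (col V j)"
  have "v = ?c"
  proof (cases "l $ j = 1")
    case True
    then have "\<forall>k\<in>{..<?d} - {j}. l $ k = 0"
      using rest pos sum_nonneg_eq_0_iff[of "{..<?d} - {j}" "\<lambda>k. l $ k"] by simp
    then have "l $ i = unit_vec ?d j $ i" if "i < ?d" for i
      using that True j by (cases "i = j") auto
    then have "l = unit_vec ?d j" using lc by (intro eq_vecI) simp_all
    then show ?thesis using vl mult_unit_vec[OF j] by simp
  next
    case False
    let ?t = "l $ j"
    have "0 \<le> (\<Sum>k\<in>{..<?d} - {j}. l $ k)" using pos by (intro sum_nonneg) simp
    then have t: "0 < ?t" "?t < 1" using lj rest False by linarith+
    \<comment> \<open>the remaining weights, rescaled to sum 1\<close>
    define l' where "l' = vec ?d (\<lambda>k. if k = j then 0 else l $ k / (1 - ?t))"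
    have "(\<Sum>k<?d. l' $ k) = (\<Sum>k\<in>{..<?d} - {j}. l $ k / (1 - ?t))"
      using j by (subst sum.remove[of _ j]) (auto simp: l'_def intro!: sum.cong)
    also have "\<dots> = 1" using rest t by (simp flip: sum_divide_distrib)
    finally have l': "l' \<in> weights ?d" using pos t by (auto simp: weights_def l'_def)
    have lsum: "l = ?t \<cdot>\<^sub>v unit_vec ?d j + (1 - ?t) \<cdot>\<^sub>v l'"
      using lc t j by (intro eq_vecI) (auto simp: l'_def)
    have "v = ?A *\<^sub>v (?t \<cdot>\<^sub>v unit_vec ?d j + (1 - ?t) \<cdot>\<^sub>v l')"
      using vl lsum by simp
    also have "\<dots> = ?t \<cdot>\<^sub>v (?A *\<^sub>v unit_vec ?d j) + (1 - ?t) \<cdot>\<^sub>v (?A *\<^sub>v l')"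
      using l' by (subst mult_add_distrib_mat_vec[of _ "dim_row V" ?d])
        (auto simp: weights_def mult_mat_vec[of _ "dim_row V" ?d])
    finally have "v = ?t \<cdot>\<^sub>v ?c + (1 - ?t) \<cdot>\<^sub>v (?A *\<^sub>v l')"
      using mult_unit_vec[OF j] by simp
    moreover have "?c \<in> polytope_of V" "?A *\<^sub>v l' \<in> polytope_of V"
      using column_in_polytope[of "col V j" V] j l' by (auto simp: polytope_of_eq cols_def)
    moreover have "x = v" if "x \<in> polytope_of V" "y \<in> polytope_of V" "0 < s" "s < 1"
      "v = s \<cdot>\<^sub>v x + (1 - s) \<cdot>\<^sub>v y" for x y s
      using v that unfolding vertices_def by blast
    ultimately show ?thesis using t by metis
  qed
  then show "v \<in> map_vec real_of_int ` set (cols V)" using j by (auto simp: cols_def)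
qed

lemma zero_one_extreme:
  fixes x y t :: real
  assumes "0 \<le> x" "x \<le> 1" "0 \<le> y" "y \<le> 1" "0 < t" "t < 1" "c = t * x + (1 - t) * y" "c = 0 \<or> c = 1"
  shows "x = c \<and> y = c"
  using assms(8)
proof
  assume "c = 0"
  moreover have "0 \<le> t * x" "0 \<le> (1 - t) * y" using assms by simp_all
  ultimately have "t * x = 0" "(1 - t) * y = 0" using assms(7) by linarith+
  then show ?thesis using assms \<open>c = 0\<close> by simp
next
  assume "c = 1"
  moreover have "0 \<le> t * (1 - x)" "0 \<le> (1 - t) * (1 - y)" using assms by simp_all
  moreover have "t * (1 - x) + (1 - t) * (1 - y) = 1 - c" using assms(7) by (simp add: algebra_simps)
  ultimately have "t * (1 - x) = 0" "(1 - t) * (1 - y) = 0" by linarith+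
  then show ?thesis using assms \<open>c = 1\<close> by simp
qed

text \<open>All points of the polytope lie in the unit cube, and the columns are extreme even in the cube: a
  coordinate with value 0 or 1 cannot be averaged from other values in the unit interval.\<close>

lemma vertices_zero_one:
  assumes 01: "\<And>i j. i < dim_row V \<Longrightarrow> j < dim_col V \<Longrightarrow> V $$ (i, j) = 0 \<or> V $$ (i, j) = 1"
  shows "vertices (polytope_of V) = map_vec real_of_int ` set (cols V)"
proof (rule antisym[OF vertices_subset_columns], clarify)
  fix c assume c: "c \<in> set (cols V)"
  let ?P = "polytope_of V" and ?c = "map_vec real_of_int c"
  have bounds: "0 \<le> x $ i \<and> x $ i \<le> 1" if x: "x \<in> ?P" and i: "i < dim_row V" for x i
  proof -
    from x obtain l where l: "l \<in> weights (dim_col V)" and xl: "x = map_mat real_of_int V *\<^sub>v l"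
      by (auto simp: polytope_of_eq)
    then have xi: "x $ i = (\<Sum>j<dim_col V. real_of_int (V $$ (i, j)) * l $ j)"
      using real_mult_mat_vec_nth[OF i] by (simp add: weights_def)
    have "0 \<le> real_of_int (V $$ (i, j)) * l $ j \<and> real_of_int (V $$ (i, j)) * l $ j \<le> l $ j"
      if "j < dim_col V" for j
      using 01[OF i that] l that by (auto simp: weights_def)
    then have "0 \<le> x $ i" "x $ i \<le> (\<Sum>j<dim_col V. l $ j)"
      unfolding xi by (auto intro!: sum_nonneg sum_mono)
    with l show ?thesis by (simp add: weights_def)
  qed
  have "x = ?c \<and> y = ?c" if xy: "x \<in> ?P" "y \<in> ?P" and t: "0 < t" "t < 1"
    and eq: "?c = t \<cdot>\<^sub>v x + (1 - t) \<cdot>\<^sub>v y" for x y and t :: real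
  proof -
    have dims: "dim_vec x = dim_row V" "dim_vec y = dim_row V" "dim_vec c = dim_row V"
      using xy c polytope_of_carrier[of V] by (auto simp: cols_def)
    have "x $ i = ?c $ i \<and> y $ i = ?c $ i" if i: "i < dim_row V" for i
    proof (rule zero_one_extreme[of _ _ t])
      show "?c $ i = t * x $ i + (1 - t) * y $ i"
        by (subst eq) (simp add: dims i)
      show "?c $ i = 0 \<or> ?c $ i = 1"
        using 01[OF i] c i by (fastforce simp: cols_def)
    qed (use bounds xy t i in auto)
    then show ?thesis using dims by (auto intro!: eq_vecI)
  qed
  then show "?c \<in> vertices ?P"
    using column_in_polytope[OF c] unfolding vertices_def by blast
qed

text \<open>The unit vectors are differences of points of the polytope, and they span the space.\<close>

lemma affine_dim_full:
  fixes V :: "int mat"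
  assumes 0: "0\<^sub>v (dim_row V) \<in> set (cols V)"
    and units: "\<And>i. i < dim_row V \<Longrightarrow> unit_vec (dim_row V) i \<in> set (cols V)"
  shows "vec_space.affine_dim (dim_row V) (polytope_of V) = dim_row V"
proof -
  define n where "n = dim_row V"
  interpret vec_space "TYPE(real)" n .
  let ?D = "{x - y | x y. x \<in> polytope_of V \<and> y \<in> polytope_of V}"
  have D: "?D \<subseteq> carrier_vec n"
    using polytope_of_carrier[of V] unfolding n_def by (blast intro: minus_carrier_vec)
  have "map_vec real_of_int (0\<^sub>v n) \<in> polytope_of V"
    using column_in_polytope[OF 0] by (simp add: n_def)
  moreover have "map_vec real_of_int (unit_vec n i) \<in> polytope_of V" if "i < n" for i
    using column_in_polytope[OF units[of i]] that by (simp add: n_def)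
  ultimately have u: "unit_vec n i \<in> ?D" if "i < n" for i
  proof -
    have "(unit_vec n i :: real vec) = map_vec real_of_int (unit_vec n i) - map_vec real_of_int (0\<^sub>v n)"
      by (rule eq_vecI) (auto simp: unit_vec_def)
    then show ?thesis using that
        \<open>map_vec real_of_int (0\<^sub>v n) \<in> polytope_of V\<close>
        \<open>\<And>i. i < n \<Longrightarrow> map_vec real_of_int (unit_vec n i) \<in> polytope_of V\<close> by blast
  qed
  have "set (unit_vecs n) \<subseteq> ?D" using u by (auto simp: unit_vecs_def)
  then have "carrier_vec n \<subseteq> span ?D"
    using span_is_monotone[of "set (unit_vecs n)" ?D] span_unit_vecs_is_carrier by simp
  then have "span ?D = carrier_vec n" using span_closed[OF D] by auto
  moreover have "module_vec TYPE(real) n\<lparr>carrier := carrier_vec n\<rparr> = module_vec TYPE(real) n"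
    by (simp add: module_vec_def)
  ultimately show ?thesis
    unfolding affine_dim_def n_def[symmetric] by (simp only: dim_is_n)
qed

section \<open>Unimodular isomorphisms in terms of vertices\<close>

lemma invertible_int_matE:
  assumes "invertible_mat (U :: int mat)" "U \<in> carrier_mat n n"
  obtains W where "W \<in> carrier_mat n n" "U * W = 1\<^sub>m n" "W * U = 1\<^sub>m n"
proof -
  from assms obtain W where W: "U * W = 1\<^sub>m n" "W * U = 1\<^sub>m (dim_row W)"
    unfolding invertible_mat_def inverts_mat_def by auto
  have "W \<in> carrier_mat n n"
    using arg_cong[OF W(1), of dim_col] arg_cong[OF W(2), of dim_col] assms(2)
    by (intro carrier_matI) simp_all
  with W show ?thesis by (intro that) auto
qed

text \<open>The integer version of the map in \<open>unimodular_isomorphic\<close>. It acts on the columns of vertex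
  matrices, which allows divisibility arguments.\<close>

definition affine_image :: "int mat \<Rightarrow> int vec \<Rightarrow> int vec \<Rightarrow> int vec" where
  "affine_image U z c = U *\<^sub>v c + z"

lemma real_affine_image:
  assumes "U \<in> carrier_mat n n" "z \<in> carrier_vec n" "c \<in> carrier_vec n"
  shows "map_vec real_of_int (affine_image U z c)
    = map_mat real_of_int U *\<^sub>v map_vec real_of_int c + map_vec real_of_int z"
  unfolding affine_image_def using assms by (intro eq_vecI) (auto simp: scalar_prod_def)

lemma convex_combination_affine:
  fixes A :: "real mat"
  assumes "A \<in> carrier_mat n n" "z \<in> carrier_vec n" "x \<in> carrier_vec n" "y \<in> carrier_vec n"
  shows "A *\<^sub>v (t \<cdot>\<^sub>v x + (1 - t) \<cdot>\<^sub>v y) + z = t \<cdot>\<^sub>v (A *\<^sub>v x + z) + (1 - t) \<cdot>\<^sub>v (A *\<^sub>v y + z)"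
proof -
  have "A *\<^sub>v (t \<cdot>\<^sub>v x + (1 - t) \<cdot>\<^sub>v y) = t \<cdot>\<^sub>v (A *\<^sub>v x) + (1 - t) \<cdot>\<^sub>v (A *\<^sub>v y)"
    using assms by (subst mult_add_distrib_mat_vec[of _ n n]) (auto simp: mult_mat_vec[of _ n n])
  then show ?thesis using assms by (intro eq_vecI) (auto simp: algebra_simps)
qed

text \<open>An injective affine map preserves and reflects convex combinations, and being a vertex is
  expressed by convex combinations alone.\<close>

lemma vertices_affine_image:
  fixes A :: "real mat"
  assumes A: "A \<in> carrier_mat n n" "B \<in> carrier_mat n n" "B * A = 1\<^sub>m n" and z: "z \<in> carrier_vec n"
    and P: "P \<subseteq> carrier_vec n"
  shows "vertices ((\<lambda>x. A *\<^sub>v x + z) ` P) = (\<lambda>x. A *\<^sub>v x + z) ` vertices P"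
proof -
  let ?f = "\<lambda>x. A *\<^sub>v x + z"
  have inv: "B *\<^sub>v (?f x - z) = x" if "x \<in> carrier_vec n" for x
  proof -
    have "?f x - z = A *\<^sub>v x" using A z that by (intro eq_vecI) auto
    moreover have "B *\<^sub>v (A *\<^sub>v x) = x"
      using A that by (simp flip: assoc_mult_mat_vec[of B n n A n x])
    ultimately show ?thesis by simp
  qed
  then have inj: "?f x = ?f y \<longleftrightarrow> x = y" if "x \<in> carrier_vec n" "y \<in> carrier_vec n" for x y
    using that by metis
  have comb: "?f v = t \<cdot>\<^sub>v ?f x + (1 - t) \<cdot>\<^sub>v ?f y \<longleftrightarrow> v = t \<cdot>\<^sub>v x + (1 - t) \<cdot>\<^sub>v y"
    if "v \<in> P" "x \<in> P" "y \<in> P" for v x y t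
  proof -
    have "v \<in> carrier_vec n" "x \<in> carrier_vec n" "y \<in> carrier_vec n" using that P by auto
    then show ?thesis
      using inj[of v "t \<cdot>\<^sub>v x + (1 - t) \<cdot>\<^sub>v y"] convex_combination_affine[OF A(1) z, of x y t] by simp
  qed
  have vert: "?f v \<in> vertices (?f ` P) \<longleftrightarrow> v \<in> vertices P" if "v \<in> P" for v
  proof -
    have "?f v \<in> vertices (?f ` P) \<longleftrightarrow> (\<forall>x\<in>P. \<forall>y\<in>P. \<forall>t::real.
        0 < t \<and> t < 1 \<and> ?f v = t \<cdot>\<^sub>v ?f x + (1 - t) \<cdot>\<^sub>v ?f y \<longrightarrow> ?f x = ?f v \<and> ?f y = ?f v)"
      using that by (auto simp: vertices_def)
    also have "\<dots> \<longleftrightarrow> v \<in> vertices P"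
      using that P inj comb unfolding vertices_def by (smt (verit) mem_Collect_eq subsetD)
    finally show ?thesis .
  qed
  have "vertices (?f ` P) \<subseteq> ?f ` P" "vertices P \<subseteq> P" by (auto simp: vertices_def)
  with vert show ?thesis by blast
qed

lemma inj_map_vec_real_of_int: "inj (map_vec real_of_int)"
  by (intro injI eq_vecI) (metis index_map_vec of_int_eq_iff)+

text \<open>Passing from polytopes to finite sets of integer vectors: an isomorphism permutes vertices, and
  the vertices are the columns.\<close>

lemma unimodular_isomorphic_columnsE:
  assumes "unimodular_isomorphic n (polytope_of V) (polytope_of V')"
    and "vertex_matrix V" "vertex_matrix V'" "dim_row V = n"
  obtains U W z where "U \<in> carrier_mat n n" "W \<in> carrier_mat n n" "z \<in> carrier_vec n"
    "U * W = 1\<^sub>m n" "W * U = 1\<^sub>m n" "affine_image U z ` set (cols V) = set (cols V')"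
proof -
  from assms(1) obtain U z where U: "U \<in> carrier_mat n n" "invertible_mat U" and z: "z \<in> carrier_vec n"
    and P': "polytope_of V' = (\<lambda>x. map_mat real_of_int U *\<^sub>v x + map_vec real_of_int z) ` polytope_of V"
    unfolding unimodular_isomorphic_def by blast
  from U obtain W where W: "W \<in> carrier_mat n n" "U * W = 1\<^sub>m n" "W * U = 1\<^sub>m n"
    by (blast elim: invertible_int_matE)
  have "map_mat real_of_int W * map_mat real_of_int U = map_mat real_of_int (W * U)"
    by (rule of_int_hom.mat_hom_mult[OF W(1) U(1), symmetric])
  then have inv: "map_mat real_of_int W * map_mat real_of_int U = 1\<^sub>m n"
    using W by (simp add: of_int_hom.mat_hom_one)
  have cols: "set (cols V) \<subseteq> carrier_vec n"
    using assms(4) cols_dim by blast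
  have "map_vec real_of_int ` set (cols V') = vertices (polytope_of V')"
    using assms(3) by (simp add: vertex_matrix_def)
  also have "\<dots> = (\<lambda>x. map_mat real_of_int U *\<^sub>v x + map_vec real_of_int z) ` vertices (polytope_of V)"
    unfolding P' using U W z inv polytope_of_carrier[of V] assms(4)
    by (intro vertices_affine_image[of _ n "map_mat real_of_int W"]) auto
  also have "\<dots> = (\<lambda>x. map_mat real_of_int U *\<^sub>v x + map_vec real_of_int z) ` map_vec real_of_int ` set (cols V)"
    using assms(2) by (simp add: vertex_matrix_def)
  also have "\<dots> = map_vec real_of_int ` affine_image U z ` set (cols V)"
    unfolding image_image using cols real_affine_image[OF U(1) z] by (intro image_cong) auto
  finally have "affine_image U z ` set (cols V) = set (cols V')"
    by (simp add: inj_image_eq_iff[OF inj_map_vec_real_of_int])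
  with U W z show ?thesis by (intro that)
qed

text \<open>The two matrices agree up to \<open>U\<close> and a permutation \<open>p\<close> of columns. Reindexing the weights by \<open>p\<close>
  turns convex combinations of one set of columns into those of the other.\<close>

lemma unimodular_isomorphic_columnsI:
  assumes U: "U \<in> carrier_mat n n" "invertible_mat U"
    and V: "dim_row V = n" "dim_row V' = n" "distinct (cols V)" "distinct (cols V')"
    and cols: "(\<lambda>c. U *\<^sub>v c) ` set (cols V) = set (cols V')"
  shows "unimodular_isomorphic n (polytope_of V) (polytope_of V')"
proof -
  define d d' where "d = dim_col V" and "d' = dim_col V'"
  obtain W where W: "W \<in> carrier_mat n n" "W * U = 1\<^sub>m n"
    using U by (blast elim: invertible_int_matE)
  have "inj_on (\<lambda>c. U *\<^sub>v c) (set (cols V))"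
  proof (rule inj_on_inverseI[of _ "\<lambda>c. W *\<^sub>v c"])
    fix c assume "c \<in> set (cols V)"
    then have "c \<in> carrier_vec n" using V cols_dim by blast
    then show "W *\<^sub>v (U *\<^sub>v c) = c"
      using U W by (simp flip: assoc_mult_mat_vec[of W n n U n c])
  qed
  then have "bij_betw (\<lambda>c. U *\<^sub>v c) (set (cols V)) (set (cols V'))"
    using cols by (simp add: bij_betw_def)
  moreover have bij: "bij_betw (\<lambda>j. cols M ! j) {..<dim_col M} (set (cols M))" if "distinct (cols M)" for M :: "int mat"
    using bij_betw_nth[OF that, of "{..<dim_col M}" "set (cols M)"] by simp
  ultimately have "bij_betw (\<lambda>j. U *\<^sub>v (cols V ! j)) {..<d} (set (cols V'))"
    using bij_betw_trans[OF bij[OF V(3)], of "\<lambda>c. U *\<^sub>v c"] by (simp add: comp_def d_def)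
  then obtain p where p: "bij_betw p {..<d} {..<d'}" and pc: "\<forall>j<d. cols V' ! p j = U *\<^sub>v (cols V ! j)"
  proof -
    let ?q = "the_inv_into {..<d'} (\<lambda>j. cols V' ! j)"
    have q: "bij_betw ?q (set (cols V')) {..<d'}"
      using bij[OF V(4)] unfolding d'_def by (rule bij_betw_the_inv_into)
    assume a: "bij_betw (\<lambda>j. U *\<^sub>v (cols V ! j)) {..<d} (set (cols V'))"
    show ?thesis
    proof (rule that)
      show "bij_betw (\<lambda>j. ?q (U *\<^sub>v (cols V ! j))) {..<d} {..<d'}"
        using bij_betw_trans[OF a q] by (simp add: comp_def)
      show "\<forall>j<d. cols V' ! ?q (U *\<^sub>v (cols V ! j)) = U *\<^sub>v (cols V ! j)"
        using a bij[OF V(4)] unfolding d'_def bij_betw_def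
        by (auto intro!: f_the_inv_into_f)
    qed
  qed
  then have pcol: "col V' (p j) = U *\<^sub>v col V j" if "j < d" for j
    using pc[rule_format, OF that] that bij_betw_apply[OF p, of j] by (simp add: d_def d'_def)
  let ?A = "map_mat real_of_int V" and ?A' = "map_mat real_of_int V'" and ?U = "map_mat real_of_int U"
  have key: "?A' *\<^sub>v l' = ?U *\<^sub>v (?A *\<^sub>v l) + map_vec real_of_int (0\<^sub>v n)"
    if l: "l \<in> carrier_vec d" "l' \<in> carrier_vec d'" and eq: "\<And>j. j < d \<Longrightarrow> l $ j = l' $ p j" for l l'
  proof (rule eq_vecI)
    fix i assume "i < dim_vec (?U *\<^sub>v (?A *\<^sub>v l) + map_vec real_of_int (0\<^sub>v n))"
    then have i: "i < n" by simp
    have "(?A' *\<^sub>v l') $ i = (\<Sum>k<d'. real_of_int (V' $$ (i, k)) * l' $ k)"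
      using real_mult_mat_vec_nth[of i V' l'] i V l by (simp add: d'_def)
    also have "\<dots> = (\<Sum>j<d. real_of_int (V' $$ (i, p j)) * l' $ p j)"
      using sum.reindex_bij_betw[OF p, of "\<lambda>k. real_of_int (V' $$ (i, k)) * l' $ k"] by simp
    also have "\<dots> = (\<Sum>j<d. (\<Sum>k<n. real_of_int (U $$ (i, k)) * real_of_int (V $$ (k, j))) * l $ j)"
    proof (intro sum.cong refl)
      fix j assume "j \<in> {..<d}"
      then have j: "j < d" by simp
      have "V' $$ (i, p j) = col V' (p j) $ i"
        using i j V bij_betw_apply[OF p, of j] by (simp add: d'_def)
      also have "\<dots> = (\<Sum>k<n. U $$ (i, k) * V $$ (k, j))"
        using i j U V by (simp add: pcol scalar_prod_def d_def atLeast0LessThan)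
      finally show "real_of_int (V' $$ (i, p j)) * l' $ p j
          = (\<Sum>k<n. real_of_int (U $$ (i, k)) * real_of_int (V $$ (k, j))) * l $ j"
        using eq[OF j] by simp
    qed
    also have "\<dots> = (\<Sum>k<n. real_of_int (U $$ (i, k)) * (\<Sum>j<d. real_of_int (V $$ (k, j)) * l $ j))"
      unfolding sum_distrib_left sum_distrib_right by (subst sum.swap) (simp add: mult.assoc)
    also have "\<dots> = (\<Sum>k<n. real_of_int (U $$ (i, k)) * (?A *\<^sub>v l) $ k)"
      using real_mult_mat_vec_nth[of _ V l] V l by (intro sum.cong) (simp_all add: d_def)
    also have "\<dots> = (?U *\<^sub>v (?A *\<^sub>v l)) $ i"
    proof -
      have "?A *\<^sub>v l \<in> carrier_vec n" using V by (intro carrier_vecI) simp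
      then show ?thesis
        using real_mult_mat_vec_nth[of i U "?A *\<^sub>v l"] U i by (simp del: index_mult_mat_vec)
    qed
    finally show "(?A' *\<^sub>v l') $ i = (?U *\<^sub>v (?A *\<^sub>v l) + map_vec real_of_int (0\<^sub>v n)) $ i"
      using i U by simp
  qed (use V U in simp)
  \<comment> \<open>weights are transported backwards along \<open>p\<close> and forwards along its inverse\<close>
  let ?q = "the_inv_into {..<d} p"
  have q: "bij_betw ?q {..<d'} {..<d}" using p by (rule bij_betw_the_inv_into)
  have qp: "?q (p j) = j" if "j < d" for j
    using that p by (simp add: bij_betw_def the_inv_into_f_f)
  have perm: "vec b (\<lambda>j. l $ r j) \<in> weights b" if "l \<in> weights a" "bij_betw r {..<b} {..<a}" for l r a b
    using that sum.reindex_bij_betw[OF that(2), of "\<lambda>k. l $ k"] bij_betw_apply[OF that(2)]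
    by (auto simp: weights_def)
  have "polytope_of V' = (\<lambda>x. ?U *\<^sub>v x + map_vec real_of_int (0\<^sub>v n)) ` polytope_of V"
  proof (intro antisym subsetI)
    fix x assume "x \<in> polytope_of V'"
    then obtain l' where l': "l' \<in> weights d'" "x = ?A' *\<^sub>v l'"
      by (auto simp: polytope_of_eq d'_def)
    then show "x \<in> (\<lambda>x. ?U *\<^sub>v x + map_vec real_of_int (0\<^sub>v n)) ` polytope_of V"
      using perm[OF l'(1) p] key[of "vec d (\<lambda>j. l' $ p j)" l']
      by (auto simp: polytope_of_eq d_def weights_def)
  next
    fix x assume "x \<in> (\<lambda>x. ?U *\<^sub>v x + map_vec real_of_int (0\<^sub>v n)) ` polytope_of V"
    then obtain l where l: "l \<in> weights d" "x = ?U *\<^sub>v (?A *\<^sub>v l) + map_vec real_of_int (0\<^sub>v n)"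
      by (auto simp: polytope_of_eq d_def)
    have "?A' *\<^sub>v vec d' (\<lambda>j. l $ ?q j) = x"
      unfolding l(2) using l(1) qp bij_betw_apply[OF p] by (intro key) (auto simp: weights_def)
    with perm[OF l(1) q] show "x \<in> polytope_of V'"
      unfolding polytope_of_eq d'_def[symmetric] by (rule image_eqI[rotated, OF _ sym])
  qed
  with U show ?thesis
    unfolding unimodular_isomorphic_def by (intro bexI[of _ U] bexI[of _ "0\<^sub>v n"]) simp_all
qed

section \<open>Polytopes of hypergraphs\<close>

definition point :: "nat \<Rightarrow> nat set \<Rightarrow> int vec" where
  "point n h = vec n (\<lambda>i. of_bool (i \<in> h))"

lemma point_simps [simp]: "dim_vec (point n h) = n" "point n h \<in> carrier_vec n"
  "i < n \<Longrightarrow> point n h $ i = of_bool (i \<in> h)"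
  by (simp_all add: point_def)

lemma inj_on_point: "inj_on (point n) (Pow {..<n})"
proof (rule inj_onI)
  fix h h' assume "h \<in> Pow {..<n}" "h' \<in> Pow {..<n}" "point n h = point n h'"
  then have "i \<in> h \<longleftrightarrow> i \<in> h'" if "i < n" for i
    using that point_simps(3)[of i n h] point_simps(3)[of i n h'] by (metis of_bool_eq_iff)
  with \<open>h \<in> Pow {..<n}\<close> \<open>h' \<in> Pow {..<n}\<close> show "h = h'" by blast
qed

lemma point_empty: "point n {} = 0\<^sub>v n"
  by (rule eq_vecI) simp_all

lemma point_singleton: "i < n \<Longrightarrow> point n {i} = unit_vec n i"
  by (rule eq_vecI) (auto simp: unit_vec_def)

text \<open>Hyperedges with at least two elements, so that their indicator vectors differ from the origin and
  from the unit vectors.\<close>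

definition hypergraph :: "nat \<Rightarrow> nat set set \<Rightarrow> bool" where
  "hypergraph n H \<longleftrightarrow> (\<forall>h\<in>H. h \<subseteq> {..<n} \<and> 2 \<le> card h)"

text \<open>The sets whose indicator vectors are the vertices of the polytope of a hypergraph.\<close>

definition vertex_sets :: "nat \<Rightarrow> nat set set \<Rightarrow> nat set set" where
  "vertex_sets n H = insert {} ((\<lambda>i. {i}) ` {..<n} \<union> H)"

text \<open>The order of the columns is left open, since it does not affect the polytope; this also makes the
  predicate convenient for matrices that are produced column by column.\<close>

definition hypergraph_matrix :: "nat \<Rightarrow> nat set set \<Rightarrow> int mat \<Rightarrow> bool" where
  "hypergraph_matrix n H V \<longleftrightarrow>
     dim_row V = n \<and> distinct (cols V) \<and> set (cols V) = point n ` vertex_sets n H"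

lemma vertex_sets_Pow: "hypergraph n H \<Longrightarrow> vertex_sets n H \<subseteq> Pow {..<n}"
  by (auto simp: hypergraph_def vertex_sets_def)

lemma finite_vertex_sets: "hypergraph n H \<Longrightarrow> finite (vertex_sets n H)"
  by (meson finite_Pow_iff finite_lessThan finite_subset vertex_sets_Pow)

lemma hyperedges_eq: "hypergraph n H \<Longrightarrow> H = {h \<in> vertex_sets n H. 2 \<le> card h}"
  by (auto simp: hypergraph_def vertex_sets_def)

lemma vertex_matrix_hypergraph:
  assumes "hypergraph n H" "hypergraph_matrix n H V"
  shows "vertex_matrix V"
proof -
  have dim: "dim_row V = n" and dist: "distinct (cols V)" and cols: "set (cols V) = point n ` vertex_sets n H"
    using assms(2) by (auto simp: hypergraph_matrix_def)
  have zero: "0\<^sub>v n \<in> set (cols V)"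
    unfolding cols by (auto simp: vertex_sets_def point_empty[symmetric])
  have units: "unit_vec n i \<in> set (cols V)" if "i < n" for i
    unfolding cols using that by (auto simp: vertex_sets_def point_singleton[symmetric])
  have "V $$ (i, j) = 0 \<or> V $$ (i, j) = 1" if "i < dim_row V" "j < dim_col V" for i j
  proof -
    have "col V j \<in> set (cols V)" using that by (simp add: cols_def)
    then obtain h where "col V j = point n h" unfolding cols by blast
    then have "col V j $ i = of_bool (i \<in> h)" using that dim by simp
    then show ?thesis using that by simp
  qed
  then have "vertices (polytope_of V) = map_vec real_of_int ` set (cols V)"
    by (rule vertices_zero_one)
  moreover have "polytope_of V \<noteq> {}"
    using column_in_polytope[OF zero] by blast
  ultimately show ?thesis
    using dist affine_dim_full[of V] zero units dim by (simp add: vertex_matrix_def)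
qed

lemma permutation_mult_point:
  assumes U: "U \<in> carrier_mat n n" "\<And>i j. i < n \<Longrightarrow> j < n \<Longrightarrow> U $$ (i, j) = of_bool (i = \<pi> j)"
    and \<pi>: "inj_on \<pi> {..<n}" and h: "h \<subseteq> {..<n}"
  shows "U *\<^sub>v point n h = point n (\<pi> ` h)"
proof (rule eq_vecI)
  fix i assume "i < dim_vec (point n (\<pi> ` h))"
  then have i: "i < n" by simp
  have fin: "finite h" using h finite_subset by blast
  have "(U *\<^sub>v point n h) $ i = (\<Sum>j<n. U $$ (i, j) * of_bool (j \<in> h))"
    using U(1) i by (simp add: scalar_prod_def atLeast0LessThan)
  also have "\<dots> = (\<Sum>j\<in>h. of_bool (i = \<pi> j))"
    using h U(2)[OF i] by (intro sum.mono_neutral_cong_right) auto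
  also have "\<dots> = (\<Sum>k\<in>\<pi> ` h. of_bool (i = k))"
    using \<pi> h by (subst sum.reindex) (auto intro: inj_on_subset)
  also have "\<dots> = of_bool (i \<in> \<pi> ` h)"
    using fin by (simp add: of_bool_def)
  finally show "(U *\<^sub>v point n h) $ i = point n (\<pi> ` h) $ i" using i by simp
qed (use U in simp)

lemma unimodular_isomorphic_hypergraphI:
  assumes H: "hypergraph n H" and V: "hypergraph_matrix n H V" "hypergraph_matrix n H' V'"
    and \<pi>: "bij_betw \<pi> {..<n} {..<n}" and iso: "(\<lambda>h. \<pi> ` h) ` H = H'"
  shows "unimodular_isomorphic n (polytope_of V) (polytope_of V')"
proof -
  have inj: "inj_on \<pi> {..<n}" and range: "\<pi> ` {..<n} = {..<n}" using \<pi> by (auto simp: bij_betw_def)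
  define U where "U = mat n n (\<lambda>(i, j). of_bool (i = \<pi> j) :: int)"
  define W where "W = mat n n (\<lambda>(i, j). of_bool (j = \<pi> i) :: int)"
  have UW: "U * W = 1\<^sub>m n"
  proof (rule eq_matI)
    fix i j assume "i < dim_row (1\<^sub>m n :: int mat)" "j < dim_col (1\<^sub>m n :: int mat)"
    then have ij: "i < n" "j < n" by simp_all
    have "(U * W) $$ (i, j) = (\<Sum>k<n. of_bool (i = \<pi> k) * of_bool (j = \<pi> k))"
      using ij by (simp add: U_def W_def scalar_prod_def atLeast0LessThan)
    also have "\<dots> = (\<Sum>k\<in>\<pi> ` {..<n}. of_bool (i = k) * of_bool (j = k))"
      using inj by (subst sum.reindex) auto
    also have "\<dots> = (\<Sum>k<n. if k = i then of_bool (j = i) else 0)"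
      unfolding range by (intro sum.cong) auto
    also have "\<dots> = 1\<^sub>m n $$ (i, j)" using ij by auto
    finally show "(U * W) $$ (i, j) = 1\<^sub>m n $$ (i, j)" .
  qed (simp_all add: U_def W_def)
  have WU: "W * U = 1\<^sub>m n"
  proof (rule eq_matI)
    fix i j assume "i < dim_row (1\<^sub>m n :: int mat)" "j < dim_col (1\<^sub>m n :: int mat)"
    then have ij: "i < n" "j < n" by simp_all
    have "(W * U) $$ (i, j) = (\<Sum>k<n. of_bool (k = \<pi> i) * of_bool (k = \<pi> j))"
      using ij by (simp add: U_def W_def scalar_prod_def atLeast0LessThan)
    also have "\<dots> = (\<Sum>k<n. if k = \<pi> i then of_bool (\<pi> i = \<pi> j) else 0)"
      by (intro sum.cong) auto
    also have "\<dots> = of_bool (\<pi> i = \<pi> j)" using ij range by auto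
    also have "\<dots> = 1\<^sub>m n $$ (i, j)" using ij inj by (auto simp: inj_on_eq_iff)
    finally show "(W * U) $$ (i, j) = 1\<^sub>m n $$ (i, j)" .
  qed (simp_all add: U_def W_def)
  have "inverts_mat U W" "inverts_mat W U"
    using UW WU by (simp_all add: inverts_mat_def U_def W_def)
  then have inv: "invertible_mat U"
    unfolding invertible_mat_def by (auto simp: U_def)
  have U: "U *\<^sub>v point n h = point n (\<pi> ` h)" if "h \<in> vertex_sets n H" for h
    using that vertex_sets_Pow[OF H] inj by (intro permutation_mult_point) (auto simp: U_def)
  have "(\<lambda>h. \<pi> ` h) ` (\<lambda>i. {i}) ` {..<n} = (\<lambda>i. {i}) ` \<pi> ` {..<n}"
    by (simp add: image_image)
  then have "(\<lambda>h. \<pi> ` h) ` vertex_sets n H = vertex_sets n H'"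
    unfolding range vertex_sets_def by (simp add: image_Un iso)
  moreover have "(\<lambda>c. U *\<^sub>v c) ` point n ` vertex_sets n H = point n ` (\<lambda>h. \<pi> ` h) ` vertex_sets n H"
    using U by (simp add: image_image)
  ultimately have "(\<lambda>c. U *\<^sub>v c) ` set (cols V) = set (cols V')"
    using V by (simp add: hypergraph_matrix_def)
  then show ?thesis
    using V inv by (intro unimodular_isomorphic_columnsI[of U]) (auto simp: hypergraph_matrix_def U_def)
qed

text \<open>The vertices with entry 1 at \<open>i\<close> are the indicators of the hyperedges through \<open>i\<close> and the unit
  vector, which accounts for the summand 1.\<close>

lemma sum_columns_at:
  assumes H: "hypergraph n H" and V: "hypergraph_matrix n H V" and i: "i < n"
  shows "(\<Sum>c\<in>set (cols V). c $ i) = int (card {h \<in> H. i \<in> h} + 1)"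
proof -
  have fin: "finite (vertex_sets n H)" using H by (rule finite_vertex_sets)
  have "(\<Sum>c\<in>set (cols V). c $ i) = (\<Sum>h\<in>vertex_sets n H. of_bool (i \<in> h))"
    using V vertex_sets_Pow[OF H] i unfolding hypergraph_matrix_def
    by (simp add: sum.reindex inj_on_subset[OF inj_on_point])
  also have "\<dots> = int (card {h \<in> vertex_sets n H. i \<in> h})"
    using fin by (simp add: of_bool_def sum.If_cases Int_def)
  also have "{h \<in> vertex_sets n H. i \<in> h} = insert {i} {h \<in> H. i \<in> h}"
    using i by (auto simp: vertex_sets_def)
  also have "card \<dots> = card {h \<in> H. i \<in> h} + 1"
  proof -
    have "finite H" using fin by (rule rev_finite_subset) (auto simp: vertex_sets_def)
    moreover have "{i} \<notin> H" using H by (auto simp: hypergraph_def)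
    ultimately show ?thesis by simp
  qed
  finally show ?thesis .
qed

text \<open>The origin is distinguished by congruences. Summing \<open>U c + z\<close> over all columns \<open>c\<close> expresses
  \<open>N z\<close>, with \<open>N\<close> the number of columns, by the coordinate sums of both matrices, all of which are
  divisible by \<open>k\<close>. Hence \<open>k\<close> divides \<open>z\<close>, while \<open>z\<close> is the image of the origin and so has entries
  0 and 1 only.\<close>

lemma translation_zero:
  assumes H: "hypergraph n H" "hypergraph n H'"
    and V: "hypergraph_matrix n H V" "hypergraph_matrix n H' V'"
    and k: "2 \<le> k" "coprime (card (vertex_sets n H)) k"
    and deg: "\<And>i. i < n \<Longrightarrow> k dvd card {h \<in> H. i \<in> h} + 1" "\<And>i. i < n \<Longrightarrow> k dvd card {h \<in> H'. i \<in> h} + 1"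
    and U: "U \<in> carrier_mat n n" "W \<in> carrier_mat n n" "W * U = 1\<^sub>m n" and z: "z \<in> carrier_vec n"
    and img: "affine_image U z ` set (cols V) = set (cols V')"
  shows "z = 0\<^sub>v n"
proof (rule eq_vecI)
  fix i assume "i < dim_vec (0\<^sub>v n :: int vec)"
  then have i: "i < n" by simp
  let ?C = "set (cols V)" and ?C' = "set (cols V')"
  have C: "?C \<subseteq> carrier_vec n" using V(1) by (auto simp: hypergraph_matrix_def)
  have inj: "inj_on (affine_image U z) ?C"
  proof (rule inj_on_inverseI[of _ "\<lambda>x. W *\<^sub>v (x - z)"])
    fix c assume "c \<in> ?C"
    then have c: "c \<in> carrier_vec n" using C by blast
    have "affine_image U z c - z = U *\<^sub>v c"
      using U z c unfolding affine_image_def by (intro eq_vecI) auto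
    then show "W *\<^sub>v (affine_image U z c - z) = c"
      using U c by (simp flip: assoc_mult_mat_vec[of W n n U n c])
  qed
  have card: "card ?C = card (vertex_sets n H)"
    using V(1) vertex_sets_Pow[OF H(1)]
    by (simp add: hypergraph_matrix_def card_image inj_on_subset[OF inj_on_point])
  have "(\<Sum>c\<in>?C'. c $ i) = (\<Sum>c\<in>?C. affine_image U z c $ i)"
    unfolding img[symmetric] by (simp add: sum.reindex[OF inj])
  also have "\<dots> = (\<Sum>c\<in>?C. (\<Sum>j<n. U $$ (i, j) * c $ j) + z $ i)"
    using C U z i by (intro sum.cong) (auto simp: affine_image_def scalar_prod_def atLeast0LessThan subset_iff)
  also have "\<dots> = (\<Sum>j<n. U $$ (i, j) * (\<Sum>c\<in>?C. c $ j)) + int (card ?C) * z $ i"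
    unfolding sum.distrib sum_distrib_left by (subst sum.swap) simp
  finally have "int (card ?C) * z $ i = (\<Sum>c\<in>?C'. c $ i) - (\<Sum>j<n. U $$ (i, j) * (\<Sum>c\<in>?C. c $ j))"
    by simp
  moreover have "int k dvd (\<Sum>c\<in>?C'. c $ i)"
    unfolding sum_columns_at[OF H(2) V(2) i] int_dvd_int_iff by (rule deg(2)[OF i])
  moreover have "int k dvd (\<Sum>j<n. U $$ (i, j) * (\<Sum>c\<in>?C. c $ j))"
    using sum_columns_at[OF H(1) V(1)] deg(1)
    by (rule_tac dvd_sum, rule_tac dvd_mult) (simp only: lessThan_iff int_dvd_int_iff)
  ultimately have "int k dvd int (card ?C) * z $ i" by simp
  then have dvd: "int k dvd z $ i"
    using k(2) unfolding card by (simp add: coprime_dvd_mult_right_iff coprime_commute)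
  have "affine_image U z (0\<^sub>v n) \<in> ?C'"
    unfolding img[symmetric] using V(1) by (auto simp: hypergraph_matrix_def vertex_sets_def point_empty[symmetric])
  moreover have "affine_image U z (0\<^sub>v n) = z"
    using U z unfolding affine_image_def by (intro eq_vecI) (auto simp: scalar_prod_def)
  ultimately obtain h where "z = point n h" using V(2) by (auto simp: hypergraph_matrix_def)
  then have "z $ i = 0 \<or> z $ i = 1" using i by simp
  with dvd k(1) show "z $ i = 0\<^sub>v n $ i" using i by auto
qed (use z in simp)

text \<open>The sum of all entries is additive over the elements of \<open>h\<close>. With \<open>W\<close> mapping vertices to
  vertices, this bounds the size of \<open>h\<close> by the number of ones in the image of its indicator.\<close>

lemma total_mult_point:
  assumes W: "W \<in> carrier_mat n n" and h: "h \<subseteq> {..<n}"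
  shows "(\<Sum>r<n. (W *\<^sub>v point n h) $ r) = (\<Sum>j\<in>h. \<Sum>r<n. (W *\<^sub>v point n {j}) $ r)"
proof -
  have e: "(W *\<^sub>v point n h') $ r = (\<Sum>j\<in>h'. W $$ (r, j))" if "r < n" "h' \<subseteq> {..<n}" for r h'
  proof -
    have "(W *\<^sub>v point n h') $ r = (\<Sum>j<n. W $$ (r, j) * of_bool (j \<in> h'))"
      using W that by (simp add: scalar_prod_def atLeast0LessThan)
    also have "\<dots> = (\<Sum>j\<in>h'. W $$ (r, j))"
      using that by (intro sum.mono_neutral_cong_right) auto
    finally show ?thesis .
  qed
  have "(\<Sum>r<n. (W *\<^sub>v point n h) $ r) = (\<Sum>r<n. \<Sum>j\<in>h. W $$ (r, j))"
    using e h by simp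
  also have "\<dots> = (\<Sum>j\<in>h. \<Sum>r<n. W $$ (r, j))" by (rule sum.swap)
  also have "\<dots> = (\<Sum>j\<in>h. \<Sum>r<n. (W *\<^sub>v point n {j}) $ r)"
    using e h by (intro sum.cong refl) auto
  finally show ?thesis .
qed

text \<open>Since \<open>U\<close> maps vertices to vertices and the origin to itself, a unit vector goes to the indicator of
  some nonempty \<open>h\<close>. The inverse \<open>W\<close> sends each unit vector in \<open>h\<close> to a nonzero vector with
  nonnegative entries, and these sum up to a unit vector; so \<open>h\<close> is a singleton. This makes \<open>U\<close> a
  permutation matrix, and the hyperedges are recovered as the vertices with at least two ones.\<close>

theorem unimodular_isomorphic_hypergraphD:
  assumes H: "hypergraph n H" "hypergraph n H'"
    and V: "hypergraph_matrix n H V" "hypergraph_matrix n H' V'"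
    and k: "2 \<le> k" "coprime (card (vertex_sets n H)) k"
    and deg: "\<And>i. i < n \<Longrightarrow> k dvd card {h \<in> H. i \<in> h} + 1" "\<And>i. i < n \<Longrightarrow> k dvd card {h \<in> H'. i \<in> h} + 1"
    and iso: "unimodular_isomorphic n (polytope_of V) (polytope_of V')"
  shows "\<exists>\<pi>. bij_betw \<pi> {..<n} {..<n} \<and> (\<lambda>h. \<pi> ` h) ` H = H'"
proof -
  have dim: "dim_row V = n" using V(1) by (simp add: hypergraph_matrix_def)
  obtain U W z where U: "U \<in> carrier_mat n n" "W \<in> carrier_mat n n" "z \<in> carrier_vec n"
    "U * W = 1\<^sub>m n" "W * U = 1\<^sub>m n" and img: "affine_image U z ` set (cols V) = set (cols V')"
    using unimodular_isomorphic_columnsE[OF iso vertex_matrix_hypergraph[OF H(1) V(1)]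
        vertex_matrix_hypergraph[OF H(2) V(2)] dim] by blast
  have z: "z = 0\<^sub>v n"
    using translation_zero[OF H V k deg U(1,2,5,3) img] by simp
  let ?P = "vertex_sets n H" and ?P' = "vertex_sets n H'"
  have lin: "affine_image U z (point n h) = U *\<^sub>v point n h" for h
    unfolding z affine_image_def using U(1) by (intro right_zero_vec) (auto intro: carrier_vecI)
  then have img': "(\<lambda>h. U *\<^sub>v point n h) ` ?P = point n ` ?P'"
    using img V by (simp add: hypergraph_matrix_def image_image)
  have WU: "W *\<^sub>v (U *\<^sub>v point n h) = point n h" for h
    using U by (simp flip: assoc_mult_mat_vec[of W n n U n "point n h"])
  have img'': "(\<lambda>h. W *\<^sub>v point n h) ` ?P' = point n ` ?P"
  proof -
    have "(\<lambda>h. W *\<^sub>v point n h) ` ?P' = (\<lambda>c. W *\<^sub>v c) ` point n ` ?P'" by (simp add: image_image)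
    also have "\<dots> = point n ` ?P" unfolding img'[symmetric] image_image WU ..
    finally show ?thesis .
  qed
  \<comment> \<open>\<open>W\<close> maps unit vectors to nonzero vertices, which have at least one entry 1\<close>
  have tot: "1 \<le> (\<Sum>r<n. (W *\<^sub>v point n {j}) $ r)" if j: "j < n" for j
  proof -
    have "{j} \<in> ?P'" using j by (simp add: vertex_sets_def)
    then obtain h where h: "h \<in> ?P" "W *\<^sub>v point n {j} = point n h" using img'' by blast
    have "U *\<^sub>v (W *\<^sub>v point n {j}) = point n {j}"
      using U by (simp flip: assoc_mult_mat_vec[of U n n W n "point n {j}"])
    then have Uh: "U *\<^sub>v point n h = point n {j}" using h by simp
    have "h \<noteq> {}"
    proof
      assume "h = {}"
      then have "(U *\<^sub>v point n h) $ j = 0" using U(1) j by (simp add: scalar_prod_def)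
      then show False using Uh j by simp
    qed
    moreover have "h \<subseteq> {..<n}" using h vertex_sets_Pow[OF H(1)] by blast
    ultimately obtain r where r: "r \<in> h" "r < n" by blast
    have "(\<Sum>r\<in>{r}. point n h $ r) \<le> (\<Sum>r<n. point n h $ r)"
      using r by (intro sum_mono2) auto
    then show ?thesis using r h(2) by simp
  qed
  have "\<exists>j<n. U *\<^sub>v point n {i} = point n {j}" if i: "i < n" for i
  proof -
    have "{i} \<in> ?P" using i by (simp add: vertex_sets_def)
    then obtain h where h: "h \<in> ?P'" "U *\<^sub>v point n {i} = point n h" using img' by blast
    have hn: "h \<subseteq> {..<n}" using h vertex_sets_Pow[OF H(2)] by blast
    have Wh: "W *\<^sub>v point n h = point n {i}" using WU[of "{i}"] h by simp
    have "(\<Sum>r<n. point n {i} $ r) = (\<Sum>r<n. if r = i then 1 else 0)"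
      by (intro sum.cong) auto
    then have 1: "(\<Sum>r<n. (W *\<^sub>v point n h) $ r) = 1" using i by (simp add: Wh)
    have "(\<Sum>j\<in>h. 1) \<le> (\<Sum>j\<in>h. \<Sum>r<n. (W *\<^sub>v point n {j}) $ r)"
      using tot hn by (intro sum_mono) auto
    then have "card h \<le> 1" using 1 total_mult_point[OF U(2) hn] by simp
    moreover have "h \<noteq> {}" using 1 total_mult_point[OF U(2) hn] by auto
    ultimately have "card h = 1"
      using finite_subset[OF hn] by (metis card_0_eq finite_lessThan le_antisym less_one linorder_not_less)
    then obtain j where "h = {j}" by (rule card_1_singletonE)
    with h hn show ?thesis by auto
  qed
  then obtain \<pi> where \<pi>: "\<And>i. i < n \<Longrightarrow> \<pi> i < n \<and> U *\<^sub>v point n {i} = point n {\<pi> i}" by metis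
  have inj: "inj_on \<pi> {..<n}"
  proof (rule inj_onI)
    fix i j assume "i \<in> {..<n}" "j \<in> {..<n}" "\<pi> i = \<pi> j"
    then have "point n {i} = point n {j}" using \<pi> WU by (metis lessThan_iff)
    then show "i = j"
      using inj_on_point[of n] \<open>i \<in> {..<n}\<close> \<open>j \<in> {..<n}\<close> by (auto dest: inj_onD)
  qed
  moreover have "\<pi> ` {..<n} \<subseteq> {..<n}" using \<pi> by auto
  ultimately have bij: "bij_betw \<pi> {..<n} {..<n}"
    using endo_inj_surj[of "{..<n}" \<pi>] by (simp add: bij_betw_def)
  have entry: "U $$ (i, j) = of_bool (i = \<pi> j)" if "i < n" "j < n" for i j
  proof -
    have "(U *\<^sub>v point n {j}) $ i = (\<Sum>k<n. if k = j then U $$ (i, j) else 0)"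
      using U(1) that by (auto simp: scalar_prod_def atLeast0LessThan intro!: sum.cong)
    then have "(U *\<^sub>v point n {j}) $ i = U $$ (i, j)" using that by simp
    then show ?thesis using \<pi>[OF that(2)] that by simp
  qed
  have Pow: "?P \<subseteq> Pow {..<n}" "?P' \<subseteq> Pow {..<n}" using H by (simp_all add: vertex_sets_Pow)
  have "U *\<^sub>v point n h = point n (\<pi> ` h)" if "h \<in> ?P" for h
    using that Pow(1) by (intro permutation_mult_point[OF U(1) entry inj]) auto
  then have eq: "point n ` (\<lambda>h. \<pi> ` h) ` ?P = point n ` ?P'"
    unfolding img'[symmetric] image_image by (intro image_cong refl) simp
  have sub: "(\<lambda>h. \<pi> ` h) ` ?P \<subseteq> Pow {..<n}" using Pow(1) \<pi> by fastforce
  have P: "(\<lambda>h. \<pi> ` h) ` ?P = ?P'"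
    using eq unfolding inj_on_image_eq_iff[OF inj_on_point sub Pow(2)] .
  have "card (\<pi> ` h) = card h" if "h \<in> ?P" for h
    using that Pow(1) inj by (intro card_image) (auto intro: inj_on_subset)
  then have "(\<lambda>h. \<pi> ` h) ` {h \<in> ?P. 2 \<le> card h} = {h \<in> ?P'. 2 \<le> card h}"
    unfolding P[symmetric] by auto
  then have "(\<lambda>h. \<pi> ` h) ` H = H'" using H hyperedges_eq by metis
  with bij show ?thesis by blast
qed

section \<open>The incidence hypergraph of a graph\<close>

text \<open>The coordinate \<open>(b, u)\<close> is the number \<open>b m + u\<close>, where \<open>m\<close> is the number of nodes. With a pair of
  own coordinates omitting \<open>c\<close>, the hyperedges of a node stay distinct from each other and from
  those of its twins, and no hyperedge is a singleton, even at isolated nodes.\<close>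

definition hyperedge :: "graph \<Rightarrow> nat \<Rightarrow> nat \<Rightarrow> nat set" where
  "hyperedge G v c = {i. i < 3 * fst G \<and>
     (i div fst G = 0 \<and> {v, i mod fst G} \<in> edges G \<or> i div fst G \<noteq> c \<and> i mod fst G = v)}"

definition hyperedges_at :: "graph \<Rightarrow> nat \<Rightarrow> nat set set" where
  "hyperedges_at G v = hyperedge G v ` {..<3}"

definition incidence_hypergraph :: "graph \<Rightarrow> nat set set" where
  "incidence_hypergraph G = (\<Union>v<fst G. hyperedges_at G v)"

lemma block_index:
  assumes "v < m" "b < 3"
  shows "b * m + v < 3 * m" "(b * m + v) div m = b" "(b * m + v) mod m = (v :: nat)"
proof -
  have "b * m \<le> 2 * m" using assms by (intro mult_right_mono) simp_all
  then show "b * m + v < 3 * m" using assms(1) by linarith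
qed (use assms in simp_all)

lemma block_indexE:
  assumes "i < 3 * (m :: nat)"
  obtains b v where "b < 3" "v < m" "i = b * m + v"
proof -
  have "m > 0" using assms by (cases m) simp_all
  then show ?thesis
    using assms by (intro that[of "i div m" "i mod m"]) (simp_all add: less_mult_imp_div_less)
qed

lemma in_hyperedge:
  assumes "u < fst G" "b < 3"
  shows "b * fst G + u \<in> hyperedge G v c \<longleftrightarrow> b = 0 \<and> {v, u} \<in> edges G \<or> b \<noteq> c \<and> u = v"
  using block_index[OF assms] by (simp add: hyperedge_def)

lemma no_loop: "simple_graph G \<Longrightarrow> {v, v} \<notin> edges G"
  unfolding simple_graph_def by (auto simp: doubleton_eq_iff subset_iff)

text \<open>Coordinates in blocks 1 and 2 belong to a single node, which determines \<open>v\<close>; and \<open>(c, v)\<close> is the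
  only own coordinate that the hyperedge \<open>(v, c)\<close> lacks, as there are no loops.\<close>

lemma hyperedge_inject:
  assumes G: "simple_graph G" and vw: "v < fst G" "w < fst G" "c < 3" "d < 3"
    and eq: "hyperedge G v c = hyperedge G w d"
  shows "v = w \<and> c = d"
proof -
  have m: "b \<noteq> c \<and> v = u \<or> b = 0 \<and> {v, u} \<in> edges G \<longleftrightarrow> b \<noteq> d \<and> w = u \<or> b = 0 \<and> {w, u} \<in> edges G"
    if "b < 3" "u < fst G" for b u
    using eq in_hyperedge[OF that(2,1), of v c] in_hyperedge[OF that(2,1), of w d] by auto
  have "v = w"
  proof -
    obtain b where b: "b < 3" "b \<noteq> 0" "b \<noteq> c"
    proof (cases "c = 1")
      case True
      then show ?thesis by (intro that[of 2]) simp_all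
    qed (intro that[of 1], simp_all)
    then show ?thesis using m[of b v] vw by auto
  qed
  moreover have "c = d"
  proof (rule ccontr)
    assume "c \<noteq> d"
    then show False
      using m[of c v] m[of d v] vw \<open>v = w\<close> no_loop[OF G, of v] by auto
  qed
  ultimately show ?thesis ..
qed

text \<open>The coordinate \<open>(b, u)\<close> lies in two of the three hyperedges of \<open>u\<close>, and if \<open>b = 0\<close> also in all three
  hyperedges of each neighbour of \<open>u\<close>.\<close>

lemma hyperedges_through:
  assumes G: "simple_graph G" and u: "u < fst G" and b: "b < 3"
  shows "card {h \<in> incidence_hypergraph G. b * fst G + u \<in> h}
    = (if b = 0 then 3 * card {v. v < fst G \<and> {v, u} \<in> edges G} else 0) + 2"
proof -
  let ?i = "b * fst G + u"
  define N where "N = (if b = 0 then {v. v < fst G \<and> {v, u} \<in> edges G} else {})"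
  \<comment> \<open>the names of the hyperedges through the coordinate\<close>
  let ?A = "N \<times> {..<3} \<union> {u} \<times> ({..<3} - {b})"
  have "{h \<in> incidence_hypergraph G. ?i \<in> h} = (\<lambda>(v, c). hyperedge G v c) ` ?A"
    using in_hyperedge[OF u b] u unfolding incidence_hypergraph_def hyperedges_at_def N_def
    by (auto simp: image_iff)
  moreover have "inj_on (\<lambda>(v, c). hyperedge G v c) ?A"
    using hyperedge_inject[OF G] u by (intro inj_onI) (auto simp: N_def split: if_splits)
  ultimately have "card {h \<in> incidence_hypergraph G. ?i \<in> h} = card ?A"
    by (simp add: card_image)
  also have "\<dots> = card (N \<times> {..<3 :: nat}) + card ({u} \<times> ({..<3} - {b}))"
    using no_loop[OF G, of u] by (intro card_Un_disjoint) (auto simp: N_def)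
  also have "\<dots> = 3 * card N + 2"
    using b by (simp add: card_cartesian_product card_Diff_singleton)
  finally show ?thesis by (simp add: N_def)
qed

lemma hypergraph_incidence:
  "hypergraph (3 * fst G) (incidence_hypergraph G)"
proof -
  have "2 \<le> card (hyperedge G v c)" if v: "v < fst G" for v c
  proof -
    have "(\<lambda>b. b * fst G + v) ` ({..<3} - {c}) \<subseteq> hyperedge G v c"
      using in_hyperedge[OF v] by auto
    moreover have "inj_on (\<lambda>b. b * fst G + v) ({..<3} - {c})"
      using v by (intro inj_onI) auto
    moreover have "finite (hyperedge G v c)" by (simp add: hyperedge_def)
    ultimately have "card ({..<3} - {c}) \<le> card (hyperedge G v c)"
      by (metis card_image card_mono)
    moreover have "2 \<le> card ({..<3 :: nat} - {c})" by (simp add: card_Diff_singleton_if)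
    ultimately show ?thesis by simp
  qed
  then show ?thesis
    by (auto simp: hypergraph_def incidence_hypergraph_def hyperedges_at_def hyperedge_def)
qed

text \<open>One origin, \<open>3m\<close> unit vectors and \<open>3m\<close> hyperedges, without coincidences.\<close>

lemma card_vertex_sets:
  assumes "simple_graph G"
  shows "card (vertex_sets (3 * fst G) (incidence_hypergraph G)) = 6 * fst G + 1"
proof -
  let ?H = "incidence_hypergraph G" and ?n = "3 * fst G"
  have "?H = (\<lambda>(v, c). hyperedge G v c) ` ({..<fst G} \<times> {..<3})"
    by (auto simp: incidence_hypergraph_def hyperedges_at_def)
  moreover have "inj_on (\<lambda>(v, c). hyperedge G v c) ({..<fst G} \<times> {..<3})"
    using hyperedge_inject[OF assms] by (intro inj_onI) auto
  ultimately have H: "card ?H = 3 * fst G" "finite ?H"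
    by (simp_all add: card_image card_cartesian_product)
  have big: "2 \<le> card h" if "h \<in> ?H" for h
    using hypergraph_incidence[of G] that by (simp add: hypergraph_def)
  then have disj: "(\<lambda>i. {i}) ` {..<?n} \<inter> ?H = {}" and e: "{} \<notin> (\<lambda>i. {i}) ` {..<?n} \<union> ?H"
    by fastforce+
  have "card ((\<lambda>i. {i}) ` {..<?n} \<union> ?H) = ?n + ?n"
    using H disj by (simp add: card_Un_disjoint card_image)
  with e H show ?thesis by (simp add: vertex_sets_def)
qed

text \<open>A relation between hyperedges that only refers to the hypergraph. In the incidence hypergraph it
  implies that two hyperedges belong to the same node, and the converse holds if one of them has
  index 0.\<close>

definition tied :: "nat set set \<Rightarrow> nat set \<Rightarrow> nat set \<Rightarrow> bool" where
  "tied H h k \<longleftrightarrow> (\<exists>i. i \<in> h \<and> i \<in> k \<and> card {l \<in> H. i \<in> l} = 2)"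

lemma tied_image:
  assumes inj: "inj_on \<pi> A" and H: "\<Union>H \<subseteq> A" and h: "h \<in> H" "k \<in> H"
  shows "tied ((\<lambda>h. \<pi> ` h) ` H) (\<pi> ` h) (\<pi> ` k) \<longleftrightarrow> tied H h k"
proof -
  have mem: "\<pi> i \<in> \<pi> ` l \<longleftrightarrow> i \<in> l" if "i \<in> A" "l \<in> H" for i l
    using inj H that by (auto simp: inj_on_def)
  have "inj_on (\<lambda>h. \<pi> ` h) H"
    using H inj by (intro inj_onI) (metis Sup_upper inj_on_image_eq_iff order_trans)
  then have "card {l \<in> (\<lambda>h. \<pi> ` h) ` H. \<pi> i \<in> l} = card {l \<in> H. i \<in> l}" if "i \<in> A" for i
  proof -
    assume i: "inj_on (\<lambda>h. \<pi> ` h) H"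
    have "{l \<in> (\<lambda>h. \<pi> ` h) ` H. \<pi> i \<in> l} = (\<lambda>h. \<pi> ` h) ` {l \<in> H. i \<in> l}"
      using mem[OF that] by auto
    then show ?thesis using i by (simp add: card_image inj_on_def)
  qed
  moreover have sub: "l \<subseteq> A" if "l \<in> H" for l using H that by blast
  ultimately have tr: "\<pi> i \<in> \<pi> ` h \<and> \<pi> i \<in> \<pi> ` k \<and> card {l \<in> (\<lambda>h. \<pi> ` h) ` H. \<pi> i \<in> l} = 2
      \<longleftrightarrow> i \<in> h \<and> i \<in> k \<and> card {l \<in> H. i \<in> l} = 2" if "i \<in> A" for i
    using mem[OF that h(1)] mem[OF that h(2)] that by simp
  show ?thesis
    unfolding tied_def
  proof
    assume "\<exists>j. j \<in> \<pi> ` h \<and> j \<in> \<pi> ` k \<and> card {l \<in> (\<lambda>h. \<pi> ` h) ` H. j \<in> l} = 2"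
    then obtain i where i: "i \<in> h" "\<pi> i \<in> \<pi> ` h \<and> \<pi> i \<in> \<pi> ` k \<and> card {l \<in> (\<lambda>h. \<pi> ` h) ` H. \<pi> i \<in> l} = 2"
      by (elim exE conjE imageE[of _ \<pi> h]) simp
    have "i \<in> A" using i(1) sub[OF h(1)] by (rule subsetD[rotated])
    from tr[OF this] i(2) show "\<exists>i. i \<in> h \<and> i \<in> k \<and> card {l \<in> H. i \<in> l} = 2" by iprover
  next
    assume "\<exists>i. i \<in> h \<and> i \<in> k \<and> card {l \<in> H. i \<in> l} = 2"
    then obtain i where i: "i \<in> h \<and> i \<in> k \<and> card {l \<in> H. i \<in> l} = 2" by iprover
    then have "i \<in> A" using sub[OF h(1)] by (intro subsetD[of h A]) simp_all
    from tr[OF this] i show "\<exists>j. j \<in> \<pi> ` h \<and> j \<in> \<pi> ` k \<and> card {l \<in> (\<lambda>h. \<pi> ` h) ` H. j \<in> l} = 2" by iprover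
  qed
qed

text \<open>Two hyperedges of \<open>u\<close> contain the coordinate \<open>(b, u)\<close>; if its degree is 2, there are no others. For
  isolated \<open>u\<close> this covers \<open>b = 0\<close> as well.\<close>

lemma tied_same_node:
  assumes G: "simple_graph G" and v: "v < fst G" "c < 3" and w: "w < fst G" "d < 3"
    and tied: "tied (incidence_hypergraph G) (hyperedge G v c) (hyperedge G w d)"
  shows "v = w"
proof -
  let ?H = "incidence_hypergraph G"
  from tied obtain i where i: "i \<in> hyperedge G v c" "i \<in> hyperedge G w d" and 2: "card {h \<in> ?H. i \<in> h} = 2"
    by (auto simp: tied_def)
  from i have "i < 3 * fst G" by (simp add: hyperedge_def)
  then obtain b u where b: "b < 3" "u < fst G" "i = b * fst G + u" by (rule block_indexE)
  have "hyperedge G u ` ({..<3} - {b}) \<subseteq> {h \<in> ?H. i \<in> h}"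
    using in_hyperedge[OF b(2,1)] b by (auto simp: incidence_hypergraph_def hyperedges_at_def)
  moreover have "card (hyperedge G u ` ({..<3} - {b})) = 2"
    using b hyperedge_inject[OF G b(2) b(2)]
    by (subst card_image) (auto simp: inj_on_def card_Diff_singleton)
  moreover have "finite {h \<in> ?H. i \<in> h}" using 2 by (metis card.infinite zero_neq_numeral)
  ultimately have eq: "hyperedge G u ` ({..<3} - {b}) = {h \<in> ?H. i \<in> h}"
    using 2 by (intro card_subset_eq) auto
  have "hyperedge G v c \<in> {h \<in> ?H. i \<in> h}" "hyperedge G w d \<in> {h \<in> ?H. i \<in> h}"
    using i v w by (auto simp: incidence_hypergraph_def hyperedges_at_def)
  then obtain c' d' where "c' < 3" "hyperedge G v c = hyperedge G u c'" "d' < 3" "hyperedge G w d = hyperedge G u d'"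
    unfolding eq[symmetric] by auto
  then show ?thesis using hyperedge_inject[OF G] v w b by metis
qed

text \<open>The hyperedge with index 0 contains both coordinates of \<open>v\<close> outside block 0, which have degree 2, and
  every hyperedge of \<open>v\<close> contains one of them. The hyperedges with indices 1 and 2 share no such
  coordinate, so that the hyperedge with index 0 has to serve as a link.\<close>

lemma tied_at_node:
  assumes G: "simple_graph G" and v: "v < fst G" and c: "c < 3"
  shows "tied (incidence_hypergraph G) (hyperedge G v c) (hyperedge G v 0)"
proof -
  \<comment> \<open>a block other than 0 and \<open>c\<close>\<close>
  define b :: nat where "b = (if c = 1 then 2 else 1)"
  then have b: "b < 3" "b \<noteq> 0" "b \<noteq> c" by auto
  then have "b * fst G + v \<in> hyperedge G v c" "b * fst G + v \<in> hyperedge G v 0"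
    using in_hyperedge[OF v b(1)] by auto
  moreover have "card {h \<in> incidence_hypergraph G. b * fst G + v \<in> h} = 2"
    using hyperedges_through[OF G v b(1)] b by simp
  ultimately show ?thesis unfolding tied_def by blast
qed

text \<open>The coordinates in all hyperedges of \<open>w\<close> are those of its neighbours in block 0, and the coordinates
  in some but not all hyperedges of \<open>v\<close> are those of \<open>v\<close> itself.\<close>

lemma edge_iff_hyperedges:
  assumes G: "simple_graph G" and v: "v < fst G" and w: "w < fst G"
  shows "{v, w} \<in> edges G \<longleftrightarrow>
    (\<exists>i. (\<exists>h\<in>hyperedges_at G v. i \<in> h) \<and> (\<exists>h\<in>hyperedges_at G v. i \<notin> h) \<and> (\<forall>h\<in>hyperedges_at G w. i \<in> h))"
proof
  assume "{v, w} \<in> edges G"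
  then have "{w, v} \<in> edges G" by (simp add: insert_commute)
  then have "v \<in> hyperedge G v 1" "v \<notin> hyperedge G v 0" "v \<in> hyperedge G w c" for c
    using in_hyperedge[OF v, of 0] no_loop[OF G, of v] by auto
  then show "\<exists>i. (\<exists>h\<in>hyperedges_at G v. i \<in> h) \<and> (\<exists>h\<in>hyperedges_at G v. i \<notin> h) \<and> (\<forall>h\<in>hyperedges_at G w. i \<in> h)"
    unfolding hyperedges_at_def by (intro exI[of _ v]) auto
next
  assume "\<exists>i. (\<exists>h\<in>hyperedges_at G v. i \<in> h) \<and> (\<exists>h\<in>hyperedges_at G v. i \<notin> h) \<and> (\<forall>h\<in>hyperedges_at G w. i \<in> h)"
  then obtain i c d where i: "i \<in> hyperedge G v c" "i \<notin> hyperedge G v d" "\<And>c. c < 3 \<Longrightarrow> i \<in> hyperedge G w c"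
    by (auto simp: hyperedges_at_def)
  from i(1) have "i < 3 * fst G" by (simp add: hyperedge_def)
  then obtain b u where b: "b < 3" "u < fst G" "i = b * fst G + u" by (rule block_indexE)
  have "u = v" using i(1,2) in_hyperedge[OF b(2,1)] b(3) by auto
  moreover have "{w, u} \<in> edges G" using i(3)[OF b(1)] in_hyperedge[OF b(2,1)] b(3) by auto
  ultimately show "{v, w} \<in> edges G" by (simp add: insert_commute)
qed

text \<open>An isomorphism of incidence hypergraphs maps the hyperedges of a node to hyperedges of one node,
  because it preserves the relation \<open>tied\<close>. This defines a map of nodes. It is surjective, as every
  hyperedge is an image, hence bijective; and adjacency is expressed in terms of the classes
  of hyperedges.\<close>

lemma graph_isomorphic_incidence:
  assumes G: "simple_graph G" "simple_graph G'" and eq: "fst G' = fst G"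
    and \<pi>: "bij_betw \<pi> {..<3 * fst G} {..<3 * fst G}"
    and img: "(\<lambda>h. \<pi> ` h) ` incidence_hypergraph G = incidence_hypergraph G'"
  shows "graph_isomorphic G G'"
proof -
  define m where "m = fst G"
  note m' = eq[folded m_def]
  let ?H = "incidence_hypergraph G" and ?H' = "incidence_hypergraph G'"
  have inj: "inj_on \<pi> {..<3 * m}" using \<pi> by (simp add: bij_betw_def m_def)
  have sub: "\<Union>?H \<subseteq> {..<3 * m}"
    by (auto simp: incidence_hypergraph_def hyperedges_at_def hyperedge_def m_def)
  have in_H: "hyperedge G v c \<in> ?H" if "v < m" "c < 3" for v c
    using that by (auto simp: incidence_hypergraph_def hyperedges_at_def m_def)
  have "\<exists>w d. w < m \<and> d < 3 \<and> \<pi> ` hyperedge G v c = hyperedge G' w d" if "v < m" "c < 3" for v c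
    using imageI[OF in_H[OF that], of "\<lambda>h. \<pi> ` h"] unfolding img
    by (auto simp: incidence_hypergraph_def hyperedges_at_def m')
  then obtain f g where fg: "f v c < m" "g v c < 3" "\<pi> ` hyperedge G v c = hyperedge G' (f v c) (g v c)"
    if "v < m" "c < 3" for v c by metis
  define \<phi> where "\<phi> v = f v 0" for v
  have f: "f v c = \<phi> v" if "v < m" "c < 3" for v c
  proof -
    have "tied ?H' (\<pi> ` hyperedge G v c) (\<pi> ` hyperedge G v 0)"
      unfolding img[symmetric] using tied_at_node[OF G(1), of v c] that in_H
      by (subst tied_image[OF inj sub]) (auto simp: m_def)
    then show ?thesis
      using tied_same_node[OF G(2)] fg[OF that] fg[of v 0] that unfolding \<phi>_def m' by simp
  qed
  have \<phi>_less: "\<phi> v < m" if "v < m" for v using fg(1)[OF that, of 0] by (simp add: \<phi>_def)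
  have "{..<m} \<subseteq> \<phi> ` {..<m}"
  proof
    fix w assume "w \<in> {..<m}"
    then have w: "w < m" by simp
    then have "hyperedge G' w 0 \<in> ?H'"
      unfolding incidence_hypergraph_def hyperedges_at_def m' by fastforce
    then obtain v c where vc: "v < m" "c < 3" "hyperedge G' w 0 = \<pi> ` hyperedge G v c"
      unfolding img[symmetric] by (auto simp: incidence_hypergraph_def hyperedges_at_def m_def)
    then have "w = f v c" using fg[OF vc(1,2)] hyperedge_inject[OF G(2)] w by (metis m' zero_less_numeral)
    with vc f show "w \<in> \<phi> ` {..<m}" by auto
  qed
  with \<phi>_less have range: "\<phi> ` {..<m} = {..<m}" by auto
  then have \<phi>_inj: "inj_on \<phi> {..<m}" by (intro eq_card_imp_inj_on) simp_all
  have at: "hyperedges_at G' (\<phi> v) = (\<lambda>h. \<pi> ` h) ` hyperedges_at G v" if v: "v < m" for v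
  proof (intro antisym subsetI)
    fix h assume "h \<in> (\<lambda>h. \<pi> ` h) ` hyperedges_at G v"
    then show "h \<in> hyperedges_at G' (\<phi> v)" using fg v f by (auto simp: hyperedges_at_def)
  next
    fix h assume "h \<in> hyperedges_at G' (\<phi> v)"
    then obtain c where c: "c < 3" "h = hyperedge G' (\<phi> v) c" by (auto simp: hyperedges_at_def)
    then have "h \<in> ?H'" using \<phi>_less[OF v] by (auto simp: incidence_hypergraph_def hyperedges_at_def m')
    then obtain u d where u: "u < m" "d < 3" "h = \<pi> ` hyperedge G u d"
      unfolding img[symmetric] by (auto simp: incidence_hypergraph_def hyperedges_at_def m_def)
    then have "f u d = \<phi> v" using fg[OF u(1,2)] hyperedge_inject[OF G(2)] c \<phi>_less[OF v] by (metis m')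
    then have "u = v" using f u \<phi>_inj v by (auto dest: inj_onD)
    with u show "h \<in> (\<lambda>h. \<pi> ` h) ` hyperedges_at G v" by (auto simp: hyperedges_at_def)
  qed
  have mem: "\<pi> i \<in> \<pi> ` h \<longleftrightarrow> i \<in> h" if "i < 3 * m" "h \<in> hyperedges_at G v" for i h v
    using that inj by (auto simp: inj_on_def hyperedges_at_def hyperedge_def m_def)
  have sub_at: "i < 3 * m" if "h \<in> hyperedges_at G v" "i \<in> h" for i h v
    using that by (auto simp: hyperedges_at_def hyperedge_def m_def)
  have "{\<phi> v, \<phi> w} \<in> edges G' \<longleftrightarrow> {v, w} \<in> edges G" if vw: "v < m" "w < m" for v w
  proof -
    define Q where "Q A B i \<longleftrightarrow> (\<exists>h\<in>A. i \<in> h) \<and> (\<exists>h\<in>A. i \<notin> h) \<and> (\<forall>h\<in>B. i \<in> h)"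
      for A B :: "nat set set" and i
    let ?V = "hyperedges_at G v" and ?W = "hyperedges_at G w" and ?p = "\<lambda>h. \<pi> ` h"
    have Q: "Q (?p ` ?V) (?p ` ?W) (\<pi> i) \<longleftrightarrow> Q ?V ?W i" if "i < 3 * m" for i
      using mem[OF that] by (simp add: Q_def)
    have "{\<phi> v, \<phi> w} \<in> edges G' \<longleftrightarrow> (\<exists>i. Q (?p ` ?V) (?p ` ?W) i)"
      using edge_iff_hyperedges[OF G(2), of "\<phi> v" "\<phi> w", folded Q_def] \<phi>_less vw
      unfolding at[OF vw(1)] at[OF vw(2)] m' by simp
    also have "\<dots> \<longleftrightarrow> (\<exists>i. Q ?V ?W i)"
    proof
      assume "\<exists>i. Q (?p ` ?V) (?p ` ?W) i"
      then obtain x where x: "Q (?p ` ?V) (?p ` ?W) x" ..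
      then obtain h where "h \<in> ?V" "x \<in> \<pi> ` h" by (auto simp: Q_def)
      then obtain i where "i < 3 * m" "x = \<pi> i" using sub_at by blast
      with x Q show "\<exists>i. Q ?V ?W i" by blast
    next
      assume "\<exists>i. Q ?V ?W i"
      then obtain i where i: "Q ?V ?W i" ..
      then have "i < 3 * m" using sub_at by (auto simp: Q_def)
      with i Q show "\<exists>i. Q (?p ` ?V) (?p ` ?W) i" by blast
    qed
    also have "\<dots> \<longleftrightarrow> {v, w} \<in> edges G"
      using edge_iff_hyperedges[OF G(1), of v w, folded Q_def] vw by (simp add: m_def)
    finally show ?thesis .
  qed
  with range \<phi>_inj show ?thesis
    unfolding graph_isomorphic_def nodes_def m_def[symmetric] m'
    by (intro exI[of _ \<phi>]) (simp add: bij_betw_def)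
qed

section \<open>The incidence matrix and its encoding\<close>

text \<open>A unit vector as a bit string. For \<open>v = m\<close> no bit is set, which is the state of the marked tape after
  the last row.\<close>

definition unit_bits :: "nat \<Rightarrow> nat \<Rightarrow> bool list" where
  "unit_bits m v = map (\<lambda>w. w = v) [0..<m]"

lemma length_unit_bits [simp]: "length (unit_bits m v) = m"
  by (simp add: unit_bits_def)

definition adjacency_row :: "graph \<Rightarrow> nat \<Rightarrow> bool list" where
  "adjacency_row G v = map (\<lambda>w. {v, w} \<in> edges G) [0..<fst G]"

text \<open>The six columns of a node \<open>v\<close>. A column is described by the functions that compute the entries of its
  three blocks at \<open>w\<close>, given whether \<open>w\<close> is adjacent to \<open>v\<close> and whether \<open>w = v\<close>. The first three are
  unit vectors, the other three the indicators of the hyperedges of \<open>v\<close>.\<close>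

definition column_shapes :: "(bool \<Rightarrow> bool \<Rightarrow> bool) list list" where
  "column_shapes =
     map (\<lambda>c. map (\<lambda>b adj self. self \<and> b = c) [0..<3]) [0..<3] @
     map (\<lambda>c. map (\<lambda>b adj self. b = 0 \<and> adj \<or> b \<noteq> c \<and> self) [0..<3]) [0..<3]"

definition incidence_column :: "graph \<Rightarrow> nat \<Rightarrow> (bool \<Rightarrow> bool \<Rightarrow> bool) list \<Rightarrow> bool list" where
  "incidence_column G v qs = concat (map (\<lambda>q. map2 q (adjacency_row G v) (unit_bits (fst G) v)) qs)"

definition incidence_columns :: "graph \<Rightarrow> bool list list" where
  "incidence_columns G = replicate (3 * fst G) False #
     concat (map (\<lambda>v. map (incidence_column G v) column_shapes) [0..<fst G])"

definition incidence_matrix :: "graph \<Rightarrow> int mat" where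
  "incidence_matrix G = mat (3 * fst G) (6 * fst G + 1)
     (\<lambda>(i, j). of_bool (incidence_columns G ! j ! i))"

lemma length_adjacency_row [simp]: "length (adjacency_row G v) = fst G"
  by (simp add: adjacency_row_def)

lemma encode_graph_eq:
  "encode_graph G = replicate (fst G) True @ [False] @ concat (map (adjacency_row G) [0..<fst G])"
  by (simp add: encode_graph_def encode_unary_def adjacency_row_def[abs_def])

lemma length_concat_const: "(\<And>x. x \<in> set xs \<Longrightarrow> length (f x) = k) \<Longrightarrow> length (concat (map f xs)) = length xs * k"
  by (induction xs) auto

lemma length_encode_graph: "length (encode_graph G) = fst G + 1 + fst G * fst G"
  by (simp add: encode_graph_eq length_concat_const)

lemma length_column_shapes [simp]: "length column_shapes = 6"
  by (simp add: column_shapes_def)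

lemma length_column_shape: "qs \<in> set column_shapes \<Longrightarrow> length qs = 3"
  by (auto simp: column_shapes_def)

lemma length_incidence_column: "qs \<in> set column_shapes \<Longrightarrow> length (incidence_column G v qs) = 3 * fst G"
  unfolding incidence_column_def by (subst length_concat_const[where k = "fst G"]) (auto dest: length_column_shape)

lemma length_incidence_columns: "length (incidence_columns G) = 6 * fst G + 1"
  unfolding incidence_columns_def by (simp add: length_concat_const[where k = 6])

lemma length_in_incidence_columns: "c \<in> set (incidence_columns G) \<Longrightarrow> length c = 3 * fst G"
  by (auto simp: incidence_columns_def length_incidence_column)

lemma nth_concat_blocks:
  assumes "\<And>x. x \<in> set xs \<Longrightarrow> length (f x) = m" "b < length xs" "v < m"
  shows "concat (map f xs) ! (b * m + v) = f (xs ! b) ! v"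
  using assms
proof (induction xs arbitrary: b)
  case (Cons x xs)
  show ?case
  proof (cases b)
    case 0
    then show ?thesis using Cons.prems by (simp add: nth_append)
  next
    case (Suc b')
    then show ?thesis using Cons.prems Cons.IH[of b'] by (simp add: nth_append)
  qed
qed simp

lemma nth_incidence_column:
  assumes "u < fst G" "b < 3" "length qs = 3"
  shows "incidence_column G v qs ! (b * fst G + u) = (qs ! b) ({v, u} \<in> edges G) (u = v)"
  unfolding incidence_column_def using assms
  by (subst nth_concat_blocks[where m = "fst G"]) (simp_all add: adjacency_row_def unit_bits_def)

definition column_vec :: "nat \<Rightarrow> bool list \<Rightarrow> int vec" where
  "column_vec n bs = vec n (\<lambda>i. of_bool (bs ! i))"

lemma column_vec_unit:
  assumes "c < 3" "v < fst G"
  shows "column_vec (3 * fst G) (incidence_column G v (map (\<lambda>b adj self. self \<and> b = c) [0..<3]))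
    = point (3 * fst G) {c * fst G + v}"
proof (rule eq_vecI)
  fix i assume "i < dim_vec (point (3 * fst G) {c * fst G + v})"
  then have i: "i < 3 * fst G" by simp
  then obtain b u where b: "b < 3" "u < fst G" "i = b * fst G + u" by (rule block_indexE)
  have "b * fst G + u = c * fst G + v \<longleftrightarrow> b = c \<and> u = v"
    using block_index[OF b(2,1)] block_index[OF assms(2,1)] by metis
  then show "column_vec (3 * fst G) (incidence_column G v (map (\<lambda>b adj self. self \<and> b = c) [0..<3])) $ i
      = point (3 * fst G) {c * fst G + v} $ i"
    using i b by (simp add: column_vec_def nth_incidence_column) auto
qed (simp add: column_vec_def)

lemma column_vec_hyperedge:
  "column_vec (3 * fst G) (incidence_column G v (map (\<lambda>b adj self. b = 0 \<and> adj \<or> b \<noteq> c \<and> self) [0..<3]))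
    = point (3 * fst G) (hyperedge G v c)"
proof (rule eq_vecI)
  fix i assume "i < dim_vec (point (3 * fst G) (hyperedge G v c))"
  then have i: "i < 3 * fst G" by simp
  then obtain b u where b: "b < 3" "u < fst G" "i = b * fst G + u" by (rule block_indexE)
  then show "column_vec (3 * fst G) (incidence_column G v (map (\<lambda>b adj self. b = 0 \<and> adj \<or> b \<noteq> c \<and> self) [0..<3])) $ i
      = point (3 * fst G) (hyperedge G v c) $ i"
    using i by (simp add: column_vec_def nth_incidence_column in_hyperedge)
qed (simp add: column_vec_def)

lemma cols_incidence_matrix:
  "cols (incidence_matrix G) = map (column_vec (3 * fst G)) (incidence_columns G)"
  by (intro nth_equalityI)
    (auto simp: incidence_matrix_def length_incidence_columns column_vec_def intro!: eq_vecI simp del: upt_Suc)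

text \<open>The columns run through the indicators of all vertex sets, and there are exactly as many columns as
  vertex sets; so the columns are distinct.\<close>

lemma hypergraph_matrix_incidence:
  assumes "simple_graph G"
  shows "hypergraph_matrix (3 * fst G) (incidence_hypergraph G) (incidence_matrix G)"
proof -
  let ?n = "3 * fst G" and ?H = "incidence_hypergraph G"
  have zero: "column_vec ?n (replicate ?n False) = point ?n {}"
    by (rule eq_vecI) (simp_all add: column_vec_def)
  have units: "(\<Union>v<fst G. (\<lambda>c. point ?n {c * fst G + v}) ` {..<3}) = point ?n ` (\<lambda>i. {i}) ` {..<?n}"
    (is "?L = ?R")
  proof (intro antisym subsetI)
    fix x assume "x \<in> ?L"
    then show "x \<in> ?R" using block_index(1) by auto
  next
    fix x assume "x \<in> ?R"
    then obtain i where "i < ?n" "x = point ?n {i}" by auto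
    then show "x \<in> ?L" by (auto elim!: block_indexE)
  qed
  have "set (cols (incidence_matrix G)) = insert (column_vec ?n (replicate ?n False))
     (\<Union>v<fst G. (\<lambda>qs. column_vec ?n (incidence_column G v qs)) ` set column_shapes)"
    unfolding cols_incidence_matrix incidence_columns_def
    by (simp add: image_UN image_image atLeast0LessThan)
  also have "(\<Union>v<fst G. (\<lambda>qs. column_vec ?n (incidence_column G v qs)) ` set column_shapes)
     = (\<Union>v<fst G. (\<lambda>c. point ?n {c * fst G + v}) ` {..<3} \<union> (\<lambda>c. point ?n (hyperedge G v c)) ` {..<3})"
    unfolding column_shapes_def set_append image_Un set_map image_image set_upt atLeast0LessThan
    by (intro SUP_cong refl arg_cong2[of _ _ _ _ "(\<union>)"] image_cong column_vec_unit column_vec_hyperedge) auto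
  also have "\<dots> = point ?n ` ((\<lambda>i. {i}) ` {..<?n} \<union> ?H)"
    unfolding UN_Un_distrib units image_Un
    by (simp add: incidence_hypergraph_def hyperedges_at_def image_UN image_image)
  finally have set: "set (cols (incidence_matrix G)) = point ?n ` vertex_sets ?n ?H"
    by (simp add: vertex_sets_def zero)
  have "card (set (cols (incidence_matrix G))) = 6 * fst G + 1"
    unfolding set using card_vertex_sets[OF assms] vertex_sets_Pow[OF hypergraph_incidence]
    by (simp add: card_image inj_on_subset[OF inj_on_point])
  then have "distinct (cols (incidence_matrix G))"
    by (intro card_distinct) (simp add: incidence_matrix_def)
  with set show ?thesis by (simp add: hypergraph_matrix_def incidence_matrix_def)
qed

text \<open>The encoding of consecutive matrix entries that are all 0 or 1.\<close>

definition matrix_bits :: "bool list \<Rightarrow> bool list" where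
  "matrix_bits bs = concat (map (\<lambda>b. encode_int (of_bool b)) bs)"

lemma encode_int_of_bool: "encode_int (of_bool b) = False # (if b then [True, True] else []) @ [False]"
  by (simp add: encode_int_def encode_nat_pos encode_nat_0)

lemma matrix_bits_append: "matrix_bits (as @ bs) = matrix_bits as @ matrix_bits bs"
  by (simp add: matrix_bits_def)

lemma matrix_bits_Nil: "matrix_bits [] = []"
  by (simp add: matrix_bits_def)

lemma matrix_bits_concat: "matrix_bits (concat bss) = concat (map matrix_bits bss)"
  by (induction bss) (simp_all add: matrix_bits_append matrix_bits_Nil)

lemma concat_matrix_entries:
  assumes "\<And>c. c \<in> set cs \<Longrightarrow> length c = n"
  shows "concat [encode_int (of_bool (cs ! j ! i)). j \<leftarrow> [0..<length cs], i \<leftarrow> [0..<n]] = matrix_bits (concat cs)"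
  using assms
proof (induction cs rule: rev_induct)
  case (snoc c cs)
  have 1: "concat [encode_int (of_bool ((cs @ [c]) ! j ! i)). j \<leftarrow> [0..<length cs], i \<leftarrow> [0..<n]]
      = concat [encode_int (of_bool (cs ! j ! i)). j \<leftarrow> [0..<length cs], i \<leftarrow> [0..<n]]"
    by (intro arg_cong[of _ _ concat] map_cong refl) (simp add: nth_append)
  have "map (\<lambda>i. encode_int (of_bool (c ! i))) [0..<n] = map (\<lambda>b. encode_int (of_bool b)) c"
    using snoc.prems by (intro nth_equalityI) auto
  then show ?case
    using snoc.IH snoc.prems by (simp add: 1 matrix_bits_append) (simp add: matrix_bits_def)
qed (simp add: matrix_bits_def)

lemma encode_incidence_matrix:
  "encode_mat (incidence_matrix G) = replicate (3 * fst G) True @ [False] @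
     replicate (6 * fst G + 1) True @ [False] @ matrix_bits (concat (incidence_columns G))"
proof -
  have "[encode_int (incidence_matrix G $$ (i, j)). j \<leftarrow> [0..<6 * fst G + 1], i \<leftarrow> [0..<3 * fst G]]
     = [encode_int (of_bool (incidence_columns G ! j ! i)). j \<leftarrow> [0..<6 * fst G + 1], i \<leftarrow> [0..<3 * fst G]]"
    unfolding incidence_matrix_def
    by (intro arg_cong[of _ _ concat] map_cong refl, subst index_mat(1)) auto
  moreover have "concat [encode_int (of_bool (incidence_columns G ! j ! i)). j \<leftarrow> [0..<6 * fst G + 1], i \<leftarrow> [0..<3 * fst G]]
     = matrix_bits (concat (incidence_columns G))"
    using concat_matrix_entries[of "incidence_columns G", OF length_in_incidence_columns]
    unfolding length_incidence_columns .
  ultimately show ?thesis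
    by (simp add: encode_mat_def encode_unary_def incidence_matrix_def del: upt_Suc)
qed

section \<open>While programs on Turing machines\<close>

text \<open>The basic command acts on each tape separately, depending only on the symbol scanned on that tape.
  Interaction between the tapes is confined to the tests, which see all scanned symbols.\<close>

datatype prog =
    Basic "(nat \<Rightarrow> nat \<times> move) list"
  | Seq prog prog
  | Cond "nat list \<Rightarrow> bool" prog prog
  | While "nat list \<Rightarrow> bool" prog

fun prog_length :: "prog \<Rightarrow> nat" where
  "prog_length (Basic os) = 1"
| "prog_length (Seq p q) = prog_length p + prog_length q"
| "prog_length (Cond b p q) = prog_length p + prog_length q + 2"
| "prog_length (While b p) = prog_length p + 2"

text \<open>A command that leaves the tapes unchanged: the scanned symbols are written back.\<close>

definition jump :: "nat \<Rightarrow> nat list \<Rightarrow> nat \<times> (nat \<times> move) list" where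
  "jump q ss = (q, map (\<lambda>s. (s, Stay)) ss)"

text \<open>The code of a program, to be placed at address \<open>a\<close>. Control enters at \<open>a\<close> and leaves at the first
  address behind the code, so that sequential composition is concatenation.\<close>

fun code :: "prog \<Rightarrow> nat \<Rightarrow> machine" where
  "code (Basic os) a = [\<lambda>ss. (a + 1, map2 (\<lambda>f s. f s) os ss)]"
| "code (Seq p q) a = code p a @ code q (a + prog_length p)"
| "code (Cond b p q) a =
     [\<lambda>ss. jump (if b ss then a + 1 else a + 2 + prog_length p) ss] @ code p (a + 1) @
     [jump (a + 2 + prog_length p + prog_length q)] @ code q (a + 2 + prog_length p)"
| "code (While b p) a =
     [\<lambda>ss. jump (if b ss then a + 1 else a + 2 + prog_length p) ss] @ code p (a + 1) @ [jump a]"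

lemma length_code [simp]: "length (code p a) = prog_length p"
  by (induction p arbitrary: a) auto

fun tape_ops_within :: "nat \<Rightarrow> nat \<Rightarrow> prog \<Rightarrow> bool" where
  "tape_ops_within k g (Basic os) \<longleftrightarrow> length os = k \<and> (\<forall>f\<in>set os. \<forall>s<g. fst (f s) < g)"
| "tape_ops_within k g (Seq p q) \<longleftrightarrow> tape_ops_within k g p \<and> tape_ops_within k g q"
| "tape_ops_within k g (Cond b p q) \<longleftrightarrow> tape_ops_within k g p \<and> tape_ops_within k g q"
| "tape_ops_within k g (While b p) \<longleftrightarrow> tape_ops_within k g p"

text \<open>The condition on a single command in \<open>turing_machine\<close>, with targets bounded by \<open>e\<close>.\<close>

definition command_ok :: "nat \<Rightarrow> nat \<Rightarrow> nat \<Rightarrow> command \<Rightarrow> bool" where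
  "command_ok k g e c \<longleftrightarrow> (\<forall>ss. length ss = k \<longrightarrow> set ss \<subseteq> {0..<g} \<longrightarrow>
     (case c ss of (q, as) \<Rightarrow> q \<le> e \<and> length as = k \<and> fst ` set as \<subseteq> {0..<g}))"

lemma command_ok_mono: "command_ok k g e c \<Longrightarrow> e \<le> e' \<Longrightarrow> command_ok k g e' c"
  unfolding command_ok_def by (fastforce split: prod.splits)

lemma command_ok_jump: "(\<And>ss. f ss \<le> e) \<Longrightarrow> command_ok k g e (\<lambda>ss. jump (f ss) ss)"
  unfolding command_ok_def jump_def by (force simp: image_image)

lemma command_ok_code:
  "tape_ops_within k g p \<Longrightarrow> c \<in> set (code p a) \<Longrightarrow> command_ok k g (a + prog_length p) c"
proof (induction p arbitrary: a)
  case (Basic os)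
  then show ?case
    by (auto simp: command_ok_def set_zip subset_eq)
next
  case (Seq p q)
  then show ?case
    using command_ok_mono[of k g "a + prog_length p" c]
    by (fastforce simp: add.assoc)
next
  case (Cond b p q)
  have j: "command_ok k g (a + prog_length (Cond b p q)) (jump (a + 2 + prog_length p + prog_length q))"
    using command_ok_jump[of "\<lambda>_. a + 2 + prog_length p + prog_length q"] by (simp add: eta_contract_eq)
  from Cond.prems consider
      "c = (\<lambda>ss. jump (if b ss then a + 1 else a + 2 + prog_length p) ss)"
    | "c \<in> set (code p (a + 1))" | "c = jump (a + 2 + prog_length p + prog_length q)"
    | "c \<in> set (code q (a + 2 + prog_length p))" by auto
  then show ?case
  proof cases
    case 1
    then show ?thesis by (simp only:, intro command_ok_jump) simp
  next
    case 2
    with Cond.prems have "command_ok k g (a + 1 + prog_length p) c"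
      by (intro Cond.IH(1)) simp_all
    then show ?thesis by (rule command_ok_mono) simp
  next
    case 3
    then show ?thesis using j by simp
  next
    case 4
    with Cond.prems have "command_ok k g (a + 2 + prog_length p + prog_length q) c"
      by (intro Cond.IH(2)) simp_all
    then show ?thesis by (rule command_ok_mono) simp
  qed
next
  case (While b p)
  from While.prems consider
      "c = (\<lambda>ss. jump (if b ss then a + 1 else a + 2 + prog_length p) ss)"
    | "c \<in> set (code p (a + 1))" | "c = jump a" by auto
  then show ?case
  proof cases
    case 1
    then show ?thesis by (simp only:, intro command_ok_jump) simp
  next
    case 2
    with While.prems have "command_ok k g (a + 1 + prog_length p) c"
      by (intro While.IH) simp_all
    then show ?thesis by (rule command_ok_mono) simp
  next
    case 3
    then show ?thesis using command_ok_jump[of "\<lambda>_. a"] by (simp add: eta_contract_eq)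
  qed
qed

lemma turing_machine_code:
  assumes "2 \<le> k" "3 \<le> g" "tape_ops_within k g p"
  shows "turing_machine k g (code p 0)"
  using assms command_ok_code[OF assms(3), of _ 0]
  unfolding turing_machine_def command_ok_def by simp

text \<open>Total correctness with at most \<open>B\<close> steps. The code may be surrounded by arbitrary other code; this
  is what makes the statement compositional.\<close>

definition runs :: "prog \<Rightarrow> tape list \<Rightarrow> nat \<Rightarrow> tape list \<Rightarrow> bool" where
  "runs p ts B ts' \<longleftrightarrow> (\<exists>t\<le>B. \<forall>xs ys. let M = xs @ code p (length xs) @ ys in
     (step M ^^ t) (length xs, ts) = (length xs + prog_length p, ts'))"

lemma runsI:
  assumes "t \<le> B" and "\<And>M xs ys. M = xs @ code p (length xs) @ ys \<Longrightarrow>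
     (step M ^^ t) (length xs, ts) = (length xs + prog_length p, ts')"
  shows "runs p ts B ts'"
  using assms unfolding runs_def Let_def by blast

lemma runsE:
  assumes "runs p ts B ts'"
  obtains t where "t \<le> B" and "\<And>M xs ys a. M = xs @ code p a @ ys \<Longrightarrow> a = length xs \<Longrightarrow>
     (step M ^^ t) (a, ts) = (a + prog_length p, ts')"
  using assms unfolding runs_def Let_def by blast

lemma runs_mono: "runs p ts B ts' \<Longrightarrow> B \<le> B' \<Longrightarrow> runs p ts B' ts'"
  unfolding runs_def by (meson order_trans)

lemma step_jump:
  assumes "M ! a = c" "a < length M" "c (map head_symbol ts) = jump q (map head_symbol ts)"
  shows "step M (a, ts) = (q, ts)"
proof -
  have "map2 act (map (\<lambda>s. (s, Stay)) (map head_symbol ts)) ts = ts"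
    by (induction ts) auto
  with assms show ?thesis by (simp add: jump_def)
qed

lemma funpow_trans: "(f ^^ t) x = y \<Longrightarrow> (f ^^ u) y = z \<Longrightarrow> (f ^^ (t + u)) x = z"
  by (metis add.commute comp_apply funpow_add)

lemma runs_Basic:
  "ts' = map2 (\<lambda>f t. act (f (head_symbol t)) t) os ts \<Longrightarrow> runs (Basic os) ts 1 ts'"
proof (rule runsI)
  fix M xs ys
  assume M: "M = xs @ code (Basic os) (length xs) @ ys"
    and ts': "ts' = map2 (\<lambda>f t. act (f (head_symbol t)) t) os ts"
  have "map2 act (map2 (\<lambda>f s. f s) os (map head_symbol ts)) ts
      = map2 (\<lambda>f t. act (f (head_symbol t)) t) os ts"
    by (induction os ts rule: list_induct2') auto
  then show "(step M ^^ 1) (length xs, ts) = (length xs + prog_length (Basic os), ts')"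
    by (simp add: M ts' nth_append)
qed simp

lemma runs_Seq:
  assumes "runs p ts B ts'" "runs q ts' C ts''"
  shows "runs (Seq p q) ts (B + C) ts''"
proof -
  from assms(1) obtain t where t: "t \<le> B" "\<And>M xs ys a. M = xs @ code p a @ ys \<Longrightarrow> a = length xs \<Longrightarrow>
     (step M ^^ t) (a, ts) = (a + prog_length p, ts')" by (rule runsE) blast
  from assms(2) obtain u where u: "u \<le> C" "\<And>M xs ys a. M = xs @ code q a @ ys \<Longrightarrow> a = length xs \<Longrightarrow>
     (step M ^^ u) (a, ts') = (a + prog_length q, ts'')" by (rule runsE) blast
  show ?thesis
  proof (rule runsI[of "t + u"])
    fix M xs ys
    assume M: "M = xs @ code (Seq p q) (length xs) @ ys"
    show "(step M ^^ (t + u)) (length xs, ts) = (length xs + prog_length (Seq p q), ts'')"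
      using funpow_trans[OF t(2)[where xs = xs and ys = "code q (length xs + prog_length p) @ ys"]
          u(2)[where xs = "xs @ code p (length xs)" and ys = ys], of M] M by (simp add: add.assoc)
  qed (use t u in simp)
qed

lemma runs_Cond_True:
  assumes "b (map head_symbol ts)" "runs p ts B ts'"
  shows "runs (Cond b p q) ts (B + 2) ts'"
proof -
  from assms(2) obtain t where t: "t \<le> B" "\<And>M xs ys a. M = xs @ code p a @ ys \<Longrightarrow> a = length xs \<Longrightarrow>
     (step M ^^ t) (a, ts) = (a + prog_length p, ts')" by (rule runsE) blast
  show ?thesis
  proof (rule runsI[of "1 + t + 1"])
    fix M xs ys
    assume M: "M = xs @ code (Cond b p q) (length xs) @ ys"
    let ?a = "length xs"
    have 1: "(step M ^^ 1) (?a, ts) = (?a + 1, ts)"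
      using step_jump[of M ?a _ ts "?a + 1"] assms(1) by (simp add: M)
    have 2: "(step M ^^ t) (?a + 1, ts) = (?a + 1 + prog_length p, ts')"
      using M by (intro t(2)[where xs = "xs @ [_]"]) simp_all
    have 3: "(step M ^^ 1) (?a + 1 + prog_length p, ts')
        = (?a + 2 + prog_length p + prog_length q, ts')"
      by (simp only: funpow_simps_right(2) funpow_0 One_nat_def comp_apply, rule step_jump) (simp_all add: M nth_append)
    show "(step M ^^ (1 + t + 1)) (length xs, ts) = (length xs + prog_length (Cond b p q), ts')"
      using funpow_trans[OF funpow_trans[OF 1 2] 3] by simp
  qed (use t in simp)
qed

lemma runs_Cond_False:
  assumes "\<not> b (map head_symbol ts)" "runs q ts B ts'"
  shows "runs (Cond b p q) ts (B + 1) ts'"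
proof -
  from assms(2) obtain t where t: "t \<le> B" "\<And>M xs ys a. M = xs @ code q a @ ys \<Longrightarrow> a = length xs \<Longrightarrow>
     (step M ^^ t) (a, ts) = (a + prog_length q, ts')" by (rule runsE) blast
  show ?thesis
  proof (rule runsI[of "1 + t"])
    fix M xs ys
    assume M: "M = xs @ code (Cond b p q) (length xs) @ ys"
    let ?a = "length xs"
    have 1: "(step M ^^ 1) (?a, ts) = (?a + 2 + prog_length p, ts)"
      using step_jump[of M ?a _ ts "?a + 2 + prog_length p"] assms(1) by (simp add: M)
    have 2: "(step M ^^ t) (?a + 2 + prog_length p, ts)
        = (?a + 2 + prog_length p + prog_length q, ts')"
      using M by (intro t(2)[where xs = "xs @ [_] @ code p (?a + 1) @ [_]"]) simp_all
    show "(step M ^^ (1 + t)) (length xs, ts) = (length xs + prog_length (Cond b p q), ts')"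
      using funpow_trans[OF 1 2] by simp
  qed (use t in simp)
qed

lemma runs_While_False:
  assumes "\<not> b (map head_symbol ts)"
  shows "runs (While b p) ts 1 ts"
proof (rule runsI[of 1])
  fix M xs ys
  assume M: "M = xs @ code (While b p) (length xs) @ ys"
  let ?a = "length xs"
  show "(step M ^^ 1) (?a, ts) = (?a + prog_length (While b p), ts)"
    using step_jump[of M ?a _ ts "?a + 2 + prog_length p"] assms(1) by (simp add: M)
qed simp

lemma runs_While_True:
  assumes "b (map head_symbol ts)" "runs p ts B ts'" "runs (While b p) ts' C ts''"
  shows "runs (While b p) ts (B + 2 + C) ts''"
proof -
  from assms(2) obtain t where t: "t \<le> B" "\<And>M xs ys a. M = xs @ code p a @ ys \<Longrightarrow> a = length xs \<Longrightarrow>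
     (step M ^^ t) (a, ts) = (a + prog_length p, ts')" by (rule runsE) blast
  from assms(3) obtain u where u: "u \<le> C" "\<And>M xs ys a. M = xs @ code (While b p) a @ ys \<Longrightarrow> a = length xs \<Longrightarrow>
     (step M ^^ u) (a, ts') = (a + prog_length (While b p), ts'')" by (rule runsE) blast
  show ?thesis
  proof (rule runsI[of "1 + t + 1 + u"])
    fix M xs ys
    assume M: "M = xs @ code (While b p) (length xs) @ ys"
    let ?a = "length xs"
    have 1: "(step M ^^ 1) (?a, ts) = (?a + 1, ts)"
      using step_jump[of M ?a _ ts "?a + 1"] assms(1) by (simp add: M)
    have 2: "(step M ^^ t) (?a + 1, ts) = (?a + 1 + prog_length p, ts')"
      using M by (intro t(2)[where xs = "xs @ [_]"]) simp_all
    have 3: "(step M ^^ 1) (?a + 1 + prog_length p, ts') = (?a, ts')"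
      by (simp only: funpow_simps_right(2) funpow_0 One_nat_def comp_apply, rule step_jump) (simp_all add: M nth_append)
    show "(step M ^^ (1 + t + 1 + u)) (?a, ts) = (?a + prog_length (While b p), ts'')"
      using funpow_trans[OF funpow_trans[OF funpow_trans[OF 1 2] 3] u(2)[OF M refl]] .
  qed (use t u in simp)
qed

text \<open>The form in which loops are verified: \<open>S i\<close> is the tape contents after \<open>i\<close> rounds. Each round costs
  one step for the test and one for the jump back.\<close>

lemma runs_While:
  assumes "\<And>i. i < n \<Longrightarrow> b (map head_symbol (S i))"
    and "\<And>i. i < n \<Longrightarrow> runs p (S i) B (S (Suc i))"
    and "\<not> b (map head_symbol (S n))"
  shows "runs (While b p) (S 0) (n * (B + 2) + 1) (S n)"
  using assms
proof (induction n arbitrary: S)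
  case 0
  then show ?case using runs_While_False by simp
next
  case (Suc n)
  have "runs (While b p) (S (Suc 0)) (n * (B + 2) + 1) (S (Suc n))"
    using Suc.prems by (intro Suc.IH[of "\<lambda>i. S (Suc i)"]) auto
  then have "runs (While b p) (S 0) (B + 2 + (n * (B + 2) + 1)) (S (Suc n))"
    using Suc.prems by (intro runs_While_True[of b "S 0" p B "S (Suc 0)"]) auto
  then show ?case by (rule runs_mono) simp
qed

text \<open>A halted machine stays halted, so every later time shows the same output.\<close>

lemma computes_within_code:
  assumes "runs p (snd (initial_config k xs)) B ts" "fst (ts ! 1) = string_contents ys" "B \<le> t"
  shows "computes_within k (code p 0) t xs ys"
proof -
  from assms(1) obtain u where u: "u \<le> B" "\<And>M ws zs a. M = ws @ code p a @ zs \<Longrightarrow> a = length ws \<Longrightarrow>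
     (step M ^^ u) (a, snd (initial_config k xs)) = (a + prog_length p, ts)" by (rule runsE) blast
  have 1: "(step (code p 0) ^^ u) (initial_config k xs) = (prog_length p, ts)"
    using u(2)[where ws = "[]" and a = 0 and zs = "[]"] by (simp add: initial_config_def)
  have 2: "(step (code p 0) ^^ v) (prog_length p, ts) = (prog_length p, ts)" for v
    by (induction v) simp_all
  have "(step (code p 0) ^^ t) (initial_config k xs) = (prog_length p, ts)"
    using funpow_trans[OF 1 2, of "t - u"] u assms by simp
  then show ?thesis using assms by (simp add: computes_within_def)
qed

section \<open>Elementary programs on four tapes\<close>

notation Seq (infixr ";;" 60)

text \<open>The tapes of the reduction: the input, which is never modified; the output, with the head behind the
  last bit; a tape with one bit per node, which marks the current node; and a tape with one bit
  per node whose head counts rows. The ends of the last two tapes serve as loop bounds.\<close>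

definition conf :: "bool list \<Rightarrow> int \<Rightarrow> bool list \<Rightarrow> bool list \<Rightarrow> int \<Rightarrow> bool list \<Rightarrow> int \<Rightarrow> tape list" where
  "conf xs i ys us a cs r =
     [(string_contents xs, i), (string_contents ys, int (length ys)),
      (string_contents us, a), (string_contents cs, r)]"

lemma string_contents_nth: "i < length xs \<Longrightarrow> string_contents xs (int i) = (if xs ! i then 2 else 1)"
  by (simp add: string_contents_def)

lemma string_contents_blank [simp]:
  "string_contents xs (int (length xs)) = 0" "string_contents xs (- 1) = 0"
  by (simp_all add: string_contents_def)

lemma string_contents_nonblank: "i < length xs \<Longrightarrow> string_contents xs (int i) \<noteq> 0"
  by (simp add: string_contents_nth)

text \<open>The written symbol encodes the bit, as in \<open>string_contents\<close>.\<close>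

lemma string_contents_append:
  "(string_contents xs)(int (length xs) := if b then 2 else 1) = string_contents (xs @ [b])"
  by (auto simp: string_contents_def fun_eq_iff nth_append)

lemma heads_conf:
  "map head_symbol (conf xs i ys us a cs r)
     = [string_contents xs i, 0, string_contents us a, string_contents cs r]"
  by (simp add: conf_def)

fun offset :: "move \<Rightarrow> int" where
  "offset GoLeft = - 1" | "offset Stay = 0" | "offset GoRight = 1"

definition go :: "move \<Rightarrow> nat \<Rightarrow> nat \<times> move" where
  "go d s = (s, d)"

definition put :: "bool \<Rightarrow> nat \<Rightarrow> nat \<times> move" where
  "put b s = (if b then 2 else 1, GoRight)"

lemma act_go [simp]: "act (go d (head_symbol (c, h))) (c, h) = (c, h + offset d)"
  by (cases d) (simp_all add: go_def)

lemma act_put [simp]: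
  "act (put b (head_symbol (string_contents xs, int (length xs)))) (string_contents xs, int (length xs))
     = (string_contents (xs @ [b]), int (length (xs @ [b])))"
  by (simp add: put_def string_contents_append[symmetric])

definition shift :: "move \<Rightarrow> move \<Rightarrow> move \<Rightarrow> prog" where
  "shift d d' d'' = Basic [go d, go Stay, go d', go d'']"

lemma runs_shift:
  "runs (shift d d' d'') (conf xs i ys us a cs r) 1
     (conf xs (i + offset d) ys us (a + offset d') cs (r + offset d''))"
  unfolding shift_def conf_def by (rule runs_Basic) (simp del: act.simps head_symbol.simps)

text \<open>Moving heads in a fixed pattern until a test on the scanned symbols fails.\<close>

lemma runs_scan:
  assumes "\<And>t. t < n \<Longrightarrow> b [string_contents xs (i + int t * offset d), 0,
      string_contents us (a + int t * offset d'), string_contents cs (r + int t * offset d'')]"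
    and "\<not> b [string_contents xs (i + int n * offset d), 0,
      string_contents us (a + int n * offset d'), string_contents cs (r + int n * offset d'')]"
  shows "runs (While b (shift d d' d'')) (conf xs i ys us a cs r) (3 * n + 1)
     (conf xs (i + int n * offset d) ys us (a + int n * offset d') cs (r + int n * offset d''))"
proof -
  let ?S = "\<lambda>t. conf xs (i + int t * offset d) ys us (a + int t * offset d') cs (r + int t * offset d'')"
  have "runs (While b (shift d d' d'')) (?S 0) (n * (1 + 2) + 1) (?S n)"
  proof (rule runs_While)
    fix t assume "t < n"
    show "runs (shift d d' d'') (?S t) 1 (?S (Suc t))"
      using runs_shift[of d d' d'' xs "i + int t * offset d" ys us "a + int t * offset d'" cs
          "r + int t * offset d''"]
      by (simp add: algebra_simps)
  qed (use assms in \<open>simp_all only: heads_conf simp_thms\<close>)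
  then show ?thesis by (simp, elim runs_mono) simp
qed

text \<open>The head first steps left, because at the right end it scans a blank, and finally leaves the blank to
  the left of position 0. The input head can be moved along: \<open>d'\<close> then undoes the surplus move \<open>d\<close>.\<close>

definition rewind_units :: "move \<Rightarrow> move \<Rightarrow> prog" where
  "rewind_units d d' = shift d GoLeft Stay ;; While (\<lambda>ss. ss ! 2 \<noteq> 0) (shift d GoLeft Stay) ;;
     shift d' GoRight Stay"

lemma runs_rewind_units:
  assumes "n \<le> length us" "offset d' = - offset d"
  shows "runs (rewind_units d d') (conf xs i ys us (int n) cs r) (3 * n + 3)
     (conf xs (i + int n * offset d) ys us 0 cs r)"
proof -
  have "runs (While (\<lambda>ss. ss ! 2 \<noteq> 0) (shift d GoLeft Stay))
      (conf xs (i + offset d) ys us (int n + offset GoLeft) cs (r + offset Stay)) (3 * n + 1)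
      (conf xs (i + offset d + int n * offset d) ys us (int n + offset GoLeft + int n * offset GoLeft) cs
        (r + offset Stay + int n * offset Stay))"
  proof (rule runs_scan)
    fix t assume "t < n"
    then have pos: "int n + offset GoLeft + int t * offset GoLeft = int (n - Suc t)" by simp
    show "[string_contents xs (i + offset d + int t * offset d), 0,
       string_contents us (int n + offset GoLeft + int t * offset GoLeft),
       string_contents cs (r + offset Stay + int t * offset Stay)] ! 2 \<noteq> 0"
      unfolding pos using assms(1) \<open>t < n\<close> string_contents_nonblank[of "n - Suc t" us] by simp
  qed simp
  from runs_Seq[OF runs_shift[where d' = GoLeft and d'' = Stay] runs_Seq[OF this runs_shift[of d' GoRight Stay]]]
  show ?thesis unfolding rewind_units_def using assms(2)
    by (simp add: algebra_simps, elim runs_mono) simp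
qed

definition rewind_rows :: prog where
  "rewind_rows = shift Stay Stay GoLeft ;; While (\<lambda>ss. ss ! 3 \<noteq> 0) (shift Stay Stay GoLeft) ;;
     shift Stay Stay GoRight"

lemma runs_rewind_rows:
  assumes "n \<le> length cs"
  shows "runs rewind_rows (conf xs i ys us a cs (int n)) (3 * n + 3) (conf xs i ys us a cs 0)"
proof -
  have "runs (While (\<lambda>ss. ss ! 3 \<noteq> 0) (shift Stay Stay GoLeft))
      (conf xs (i + offset Stay) ys us (a + offset Stay) cs (int n + offset GoLeft)) (3 * n + 1)
      (conf xs (i + offset Stay + int n * offset Stay) ys us (a + offset Stay + int n * offset Stay) cs
        (int n + offset GoLeft + int n * offset GoLeft))"
  proof (rule runs_scan)
    fix t assume "t < n"
    then have pos: "int n + offset GoLeft + int t * offset GoLeft = int (n - Suc t)" by simp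
    show "[string_contents xs (i + offset Stay + int t * offset Stay), 0,
       string_contents us (a + offset Stay + int t * offset Stay),
       string_contents cs (int n + offset GoLeft + int t * offset GoLeft)] ! 3 \<noteq> 0"
      unfolding pos using assms(1) \<open>t < n\<close> string_contents_nonblank[of "n - Suc t" cs] by simp
  qed simp
  from runs_Seq[OF runs_shift[where d'' = GoLeft] runs_Seq[OF this runs_shift[of Stay Stay GoRight]]]
  show ?thesis unfolding rewind_rows_def by (simp del: One_nat_def, elim runs_mono) simp
qed

definition rewind_input :: prog where
  "rewind_input = shift GoLeft Stay Stay ;; While (\<lambda>ss. ss ! 0 \<noteq> 0) (shift GoLeft Stay Stay) ;;
     shift GoRight Stay Stay"

lemma runs_rewind_input:
  assumes "n \<le> length xs"
  shows "runs rewind_input (conf xs (int n) ys us a cs r) (3 * n + 3) (conf xs 0 ys us a cs r)"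
proof -
  have "runs (While (\<lambda>ss. ss ! 0 \<noteq> 0) (shift GoLeft Stay Stay))
      (conf xs (int n + offset GoLeft) ys us (a + offset Stay) cs (r + offset Stay)) (3 * n + 1)
      (conf xs (int n + offset GoLeft + int n * offset GoLeft) ys us (a + offset Stay + int n * offset Stay) cs
        (r + offset Stay + int n * offset Stay))"
  proof (rule runs_scan)
    fix t assume "t < n"
    then have pos: "int n + offset GoLeft + int t * offset GoLeft = int (n - Suc t)" by simp
    show "[string_contents xs (int n + offset GoLeft + int t * offset GoLeft), 0,
       string_contents us (a + offset Stay + int t * offset Stay),
       string_contents cs (r + offset Stay + int t * offset Stay)] ! 0 \<noteq> 0"
      unfolding pos using assms(1) \<open>t < n\<close> string_contents_nonblank[of "n - Suc t" xs] by simp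
  qed simp
  from runs_Seq[OF runs_shift[where d = GoLeft] runs_Seq[OF this runs_shift[of GoRight Stay Stay]]]
  show ?thesis unfolding rewind_input_def by (simp, elim runs_mono) simp
qed

fun emit :: "bool list \<Rightarrow> prog" where
  "emit [] = shift Stay Stay Stay"
| "emit (b # bs) = Basic [go Stay, put b, go Stay, go Stay] ;; emit bs"

lemma runs_emit:
  "runs (emit bs) (conf xs i ys us a cs r) (length bs + 1) (conf xs i (ys @ bs) us a cs r)"
proof (induction bs arbitrary: ys)
  case Nil
  then show ?case using runs_shift[of Stay Stay Stay xs i ys us a cs r] by simp
next
  case (Cons b bs)
  have "runs (Basic [go Stay, put b, go Stay, go Stay]) (conf xs i ys us a cs r) 1
      (conf xs i (ys @ [b]) us a cs r)"
    unfolding conf_def by (rule runs_Basic) (simp del: act.simps head_symbol.simps)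
  from runs_Seq[OF this Cons.IH] show ?case by simp
qed

text \<open>Repeated output with one repetition per cell of the unit tape. Since the dimensions of the
  matrix are linear in the number of nodes, this writes them in unary, and likewise the zeros of the first column.\<close>

definition emit_per_node :: "bool list \<Rightarrow> prog" where
  "emit_per_node bs = While (\<lambda>ss. ss ! 2 \<noteq> 0) (emit bs ;; shift Stay GoRight Stay) ;;
     rewind_units Stay Stay"

lemma runs_emit_per_node:
  assumes "length us = m"
  shows "runs (emit_per_node bs) (conf xs i ys us 0 cs r) (m * (length bs + 7) + 4)
    (conf xs i (ys @ concat (replicate m bs)) us 0 cs r)"
proof -
  let ?S = "\<lambda>t. conf xs i (ys @ concat (replicate t bs)) us (int t) cs r"
  have "runs (While (\<lambda>ss. ss ! 2 \<noteq> 0) (emit bs ;; shift Stay GoRight Stay)) (?S 0)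
      (m * (length bs + 2 + 2) + 1) (?S m)"
  proof (rule runs_While)
    fix t assume "t < m"
    have "concat (replicate t bs) @ bs = concat (replicate (Suc t) bs)"
      by (induction t) simp_all
    then show "runs (emit bs ;; shift Stay GoRight Stay) (?S t) (length bs + 2) (?S (Suc t))"
      using runs_Seq[OF runs_emit runs_shift[of Stay GoRight Stay],
          of bs xs i "ys @ concat (replicate t bs)" us "int t" cs r]
      by (simp add: add.commute del: replicate_Suc)
  next
    fix t assume "t < m"
    then show "map head_symbol (?S t) ! 2 \<noteq> 0"
      using string_contents_nonblank[of t us] assms by (simp add: heads_conf)
  next
    show "\<not> map head_symbol (?S m) ! 2 \<noteq> 0"
      using assms by (simp add: heads_conf flip: assms)
  qed
  then have "runs (While (\<lambda>ss. ss ! 2 \<noteq> 0) (emit bs ;; shift Stay GoRight Stay))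
      (conf xs i ys us 0 cs r) (m * (length bs + 4) + 1) (?S m)"
    by (simp, elim runs_mono) (simp add: algebra_simps)
  from runs_Seq[OF this runs_rewind_units[of m us Stay Stay]] assms
  show ?thesis unfolding emit_per_node_def by (auto simp: algebra_simps elim: runs_mono)
qed

lemma unit_bits_past: "unit_bits m m = replicate m False"
  by (rule nth_equalityI) (simp_all add: unit_bits_def)

text \<open>One block of a column: the current row of the adjacency matrix and the unit tape are read in parallel,
  and both heads return to where they started.\<close>

definition emit_block :: "(bool \<Rightarrow> bool \<Rightarrow> bool) \<Rightarrow> prog" where
  "emit_block q = While (\<lambda>ss. ss ! 2 \<noteq> 0)
       (emit [False] ;; Cond (\<lambda>ss. q (ss ! 0 = 2) (ss ! 2 = 2)) (emit [True, True]) (emit []) ;;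
        emit [False] ;; shift GoRight GoRight Stay) ;;
     rewind_units GoLeft GoRight"

lemma runs_emit_block:
  assumes us: "length us = m" and rs: "length rs = m" and xs: "xs = pre @ rs @ post"
  shows "runs (emit_block q) (conf xs (int (length pre)) ys us 0 cs r) (15 * m + 4)
    (conf xs (int (length pre)) (ys @ matrix_bits (map2 q rs us)) us 0 cs r)"
proof -
  let ?i = "int (length pre)"
  let ?b = "emit [False] ;; Cond (\<lambda>ss. q (ss ! 0 = 2) (ss ! 2 = 2)) (emit [True, True]) (emit []) ;;
        emit [False] ;; shift GoRight GoRight Stay"
  let ?S = "\<lambda>t. conf xs (?i + int t) (ys @ matrix_bits (map2 q (take t rs) (take t us))) us (int t) cs r"
  have "runs (While (\<lambda>ss. ss ! 2 \<noteq> 0) ?b) (?S 0) (m * (10 + 2) + 1) (?S m)"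
  proof (rule runs_While)
    fix t assume t: "t < m"
    let ?c = "q (rs ! t) (us ! t)"
    let ?ys = "ys @ matrix_bits (map2 q (take t rs) (take t us))"
    have 1: "string_contents us (int t) = (if us ! t then 2 else 1)"
      using t us by (simp add: string_contents_nth)
    have 2: "string_contents xs (?i + int t) = (if rs ! t then 2 else 1)"
      using t rs xs string_contents_nth[of "length pre + t" xs] by (simp add: nth_append)
    have bit: "(if b then 2 else 1) = (2 :: nat) \<longleftrightarrow> b" for b by simp
    show "map head_symbol (?S t) ! 2 \<noteq> 0"
      using 1 by (simp add: heads_conf)
    have "runs (Cond (\<lambda>ss. q (ss ! 0 = 2) (ss ! 2 = 2)) (emit [True, True]) (emit []))
      (conf xs (?i + int t) zs us (int t) cs r) 5
      (conf xs (?i + int t) (zs @ (if ?c then [True, True] else [])) us (int t) cs r)" for zs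
    proof (cases ?c)
      case True
      then show ?thesis
        using runs_mono[OF runs_Cond_True[OF _ runs_emit], of "\<lambda>ss. q (ss ! 0 = 2) (ss ! 2 = 2)" xs "?i + int t" zs us
            "int t" cs r "[True, True]" 5 "emit []"]
        by (simp add: heads_conf 1 2 bit del: emit.simps)
    next
      case False
      then show ?thesis
        using runs_mono[OF runs_Cond_False[OF _ runs_emit], of "\<lambda>ss. q (ss ! 0 = 2) (ss ! 2 = 2)" xs "?i + int t" zs us
            "int t" cs r "[]" 5 "emit [True, True]"] by (simp add: heads_conf 1 2 bit del: emit.simps)
    qed
    from runs_Seq[OF runs_emit[where bs = "[False]" and ys = ?ys]
        runs_Seq[OF this runs_Seq[OF runs_emit[where bs = "[False]"]
            runs_shift[where d = GoRight and d' = GoRight and d'' = Stay]]]]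
    have "runs ?b (?S t) 10 (conf xs (?i + int t + 1)
        (?ys @ [False] @ (if ?c then [True, True] else []) @ [False]) us (int t + 1) cs r)"
      by (auto elim: runs_mono)
    moreover have "matrix_bits (map2 q (take (Suc t) rs) (take (Suc t) us))
        = matrix_bits (map2 q (take t rs) (take t us)) @ [False] @ (if ?c then [True, True] else []) @ [False]"
      using t us rs by (simp add: take_Suc_conv_app_nth matrix_bits_append)
        (simp add: matrix_bits_def encode_int_of_bool)
    ultimately show "runs ?b (?S t) 10 (?S (Suc t))"
      by (simp add: algebra_simps)
  next
    show "\<not> map head_symbol (?S m) ! 2 \<noteq> 0"
      using us by (simp add: heads_conf flip: us)
  qed
  then have "runs (While (\<lambda>ss. ss ! 2 \<noteq> 0) ?b) (conf xs ?i ys us 0 cs r) (12 * m + 1)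
     (conf xs (?i + int m) (ys @ matrix_bits (map2 q rs us)) us (int m) cs r)"
    using us rs by (simp add: matrix_bits_def mult.commute)
  from runs_Seq[OF this runs_rewind_units[of m us GoRight GoLeft]] us
  show ?thesis unfolding emit_block_def by (auto elim: runs_mono)
qed

fun emit_blocks :: "(bool \<Rightarrow> bool \<Rightarrow> bool) list \<Rightarrow> prog" where
  "emit_blocks [] = shift Stay Stay Stay"
| "emit_blocks (q # qs) = emit_block q ;; emit_blocks qs"

lemma runs_emit_blocks:
  assumes "length us = m" "length rs = m" "xs = pre @ rs @ post"
  shows "runs (emit_blocks qs) (conf xs (int (length pre)) ys us 0 cs r) (length qs * (15 * m + 4) + 1)
    (conf xs (int (length pre)) (ys @ concat (map (\<lambda>q. matrix_bits (map2 q rs us)) qs)) us 0 cs r)"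
proof (induction qs arbitrary: ys)
  case Nil
  then show ?case using runs_shift[of Stay Stay Stay] by (auto intro: runs_shift[of Stay Stay Stay, simplified])
next
  case (Cons q qs)
  from runs_Seq[OF runs_emit_block[OF assms] Cons.IH] show ?case by (simp add: algebra_simps)
qed

definition skip_row :: prog where
  "skip_row = While (\<lambda>ss. ss ! 2 \<noteq> 0) (shift GoRight GoRight Stay) ;; rewind_units Stay Stay"

lemma runs_skip_row:
  assumes "length us = m"
  shows "runs skip_row (conf xs i ys us 0 cs r) (6 * m + 4) (conf xs (i + int m) ys us 0 cs r)"
proof -
  have "runs (While (\<lambda>ss. ss ! 2 \<noteq> 0) (shift GoRight GoRight Stay)) (conf xs i ys us 0 cs r) (3 * m + 1)
     (conf xs (i + int m * offset GoRight) ys us (0 + int m * offset GoRight) cs (r + int m * offset Stay))"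
    using string_contents_nonblank[of _ us] string_contents_blank(1)[of us]
    by (intro runs_scan) (simp_all add: assms)
  then have "runs (While (\<lambda>ss. ss ! 2 \<noteq> 0) (shift GoRight GoRight Stay)) (conf xs i ys us 0 cs r) (3 * m + 1)
     (conf xs (i + int m) ys us (int m) cs r)" by simp
  from runs_Seq[OF this runs_rewind_units[of m us Stay Stay]] assms
  show ?thesis unfolding skip_row_def by (auto elim: runs_mono)
qed

text \<open>Marking the current cell, unless it is the blank at the end of the tape: this happens when there are
  no nodes, and after the last row.\<close>

definition mark :: prog where
  "mark = Basic [go Stay, go Stay, \<lambda>s. (if s = 0 then 0 else 2, Stay), go Stay]"

lemma runs_mark:
  assumes "v \<le> m"
  shows "runs mark (conf xs i ys (replicate m False) (int v) cs r) 1
    (conf xs i ys (unit_bits m v) (int v) cs r)"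
proof -
  have "(string_contents (replicate m False))
      (int v := if string_contents (replicate m False) (int v) = 0 then 0 else 2)
      = string_contents (unit_bits m v)"
    using assms by (auto simp: string_contents_def fun_eq_iff unit_bits_def)
  then show ?thesis unfolding mark_def conf_def
    by (intro runs_Basic) (simp add: go_def fun_upd_idem)
qed

definition move_mark :: prog where
  "move_mark = While (\<lambda>ss. ss ! 2 = 1) (shift Stay GoRight Stay) ;;
     Basic [go Stay, go Stay, put False, go Stay] ;; mark ;; rewind_units Stay Stay"

lemma runs_move_mark:
  assumes "v < m"
  shows "runs move_mark (conf xs i ys (unit_bits m v) 0 cs r) (6 * m + 6)
    (conf xs i ys (unit_bits m (Suc v)) 0 cs r)"
proof -
  have s: "string_contents (unit_bits m v) (int w) = (if w = v then 2 else 1)" if "w \<le> v" for w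
    using that assms string_contents_nth[of w "unit_bits m v"] by (simp add: unit_bits_def)
  have "runs (While (\<lambda>ss. ss ! 2 = 1) (shift Stay GoRight Stay)) (conf xs i ys (unit_bits m v) 0 cs r) (3 * v + 1)
     (conf xs (i + int v * offset Stay) ys (unit_bits m v) (0 + int v * offset GoRight) cs (r + int v * offset Stay))"
    using s by (intro runs_scan) auto
  then have 1: "runs (While (\<lambda>ss. ss ! 2 = 1) (shift Stay GoRight Stay)) (conf xs i ys (unit_bits m v) 0 cs r) (3 * v + 1)
     (conf xs i ys (unit_bits m v) (int v) cs r)" by simp
  have "(string_contents (unit_bits m v))(int v := Suc 0) = string_contents (replicate m False)"
    using assms by (auto simp: string_contents_def fun_eq_iff unit_bits_def)
  then have 2: "runs (Basic [go Stay, go Stay, put False, go Stay]) (conf xs i ys (unit_bits m v) (int v) cs r) 1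
     (conf xs i ys (replicate m False) (int (Suc v)) cs r)"
    unfolding conf_def by (intro runs_Basic) (simp add: go_def put_def fun_upd_idem)
  have "runs move_mark (conf xs i ys (unit_bits m v) 0 cs r)
      (3 * v + 1 + (1 + (1 + (3 * Suc v + 3)))) (conf xs (i + int (Suc v) * offset Stay) ys (unit_bits m (Suc v)) 0 cs r)"
    unfolding move_mark_def using assms
    by (intro runs_Seq[OF 1 runs_Seq[OF 2 runs_Seq[OF runs_mark runs_rewind_units]]]) auto
  then show ?thesis using assms by (auto elim: runs_mono)
qed

section \<open>The program of the reduction\<close>

text \<open>The input head enters at the encoding of a graph and leaves behind it, with all other heads
  back at 0 and the mark removed. Therefore the program can be run again for a second graph of the
  same size.\<close>

definition emit_incidence_matrix :: prog where
  "emit_incidence_matrix =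
     While (\<lambda>ss. ss ! 0 = 2) (shift GoRight Stay Stay) ;; shift GoRight Stay Stay ;;
     emit_per_node (replicate 3 True) ;; emit [False] ;;
     emit_per_node (replicate 6 True) ;; emit [True, False] ;;
     emit_per_node (matrix_bits (replicate 3 False)) ;; mark ;;
     While (\<lambda>ss. ss ! 3 \<noteq> 0)
       (emit_blocks (concat column_shapes) ;; skip_row ;; move_mark ;; shift Stay Stay GoRight) ;;
     rewind_rows"

lemma concat_replicate_replicate: "concat (replicate m (replicate k x)) = replicate (k * m) x"
  by (induction m) (simp_all add: replicate_add)

text \<open>In round \<open>v\<close> the input head is at the beginning of row \<open>v\<close> of the adjacency matrix, and the unit tape
  marks \<open>v\<close>. There are 6 columns of 3 blocks, hence 18 blocks per round.\<close>

lemma runs_columns_of_nodes: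
  fixes G :: graph
  defines "m \<equiv> fst G"
  defines "F \<equiv> \<lambda>v. matrix_bits (concat (map (incidence_column G v) column_shapes))"
  assumes xs: "xs = pre @ concat (map (adjacency_row G) [0..<m]) @ post"
  shows "runs (While (\<lambda>ss. ss ! 3 \<noteq> 0)
       (emit_blocks (concat column_shapes) ;; skip_row ;; move_mark ;; shift Stay Stay GoRight))
     (conf xs (int (length pre)) ys (unit_bits m 0) 0 (replicate m True) 0) (m * (282 * m + 86) + 1)
     (conf xs (int (length pre + m * m)) (ys @ concat (map F [0..<m])) (unit_bits m m) 0 (replicate m True) (int m))"
proof -
  let ?S = "\<lambda>v. conf xs (int (length pre + v * m)) (ys @ concat (map F [0..<v])) (unit_bits m v) 0
     (replicate m True) (int v)"
  let ?b = "emit_blocks (concat column_shapes) ;; skip_row ;; move_mark ;; shift Stay Stay GoRight"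
  have "runs (While (\<lambda>ss. ss ! 3 \<noteq> 0) ?b) (?S 0) (m * (282 * m + 84 + 2) + 1) (?S m)"
  proof (rule runs_While)
    fix v assume v: "v < m"
    then show "map head_symbol (?S v) ! 3 \<noteq> 0"
      using string_contents_nonblank[of v "replicate m True"] by (simp add: heads_conf)
    let ?pre = "pre @ concat (map (adjacency_row G) [0..<v])"
    have len: "length ?pre = length pre + v * m"
      by (simp add: length_concat_const[where k = m] m_def)
    have "[0..<m] = [0..<v] @ v # [Suc v..<m]"
      using v by (metis append_Cons le_add1 less_imp_le_nat upt_conv_Cons upt_add_eq_append le_add_diff_inverse zero_le)
    then have split: "xs = ?pre @ adjacency_row G v @ (concat (map (adjacency_row G) [Suc v..<m]) @ post)"
      using xs by simp
    have len18: "length (concat column_shapes) = 18"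
      using length_concat_const[of column_shapes "\<lambda>x. x" 3] by (simp add: length_column_shape)
    have F: "concat (map (\<lambda>q. matrix_bits (map2 q (adjacency_row G v) (unit_bits m v))) (concat column_shapes)) = F v"
    proof -
      have "concat (map (\<lambda>q. matrix_bits (map2 q (adjacency_row G v) (unit_bits m v))) (concat qss))
          = matrix_bits (concat (map (incidence_column G v) qss))" for qss
        by (induction qss)
          (simp_all add: matrix_bits_append matrix_bits_concat incidence_column_def m_def comp_def
            matrix_bits_Nil)
      then show ?thesis by (simp add: F_def)
    qed
    have 1: "runs (emit_blocks (concat column_shapes)) (?S v) (18 * (15 * m + 4) + 1)
       (conf xs (int (length pre + v * m)) ((ys @ concat (map F [0..<v])) @ F v) (unit_bits m v) 0
         (replicate m True) (int v))"
      using runs_emit_blocks[OF _ _ split, of "unit_bits m v" m "concat column_shapes"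
          "ys @ concat (map F [0..<v])" "replicate m True" "int v"]
      unfolding len len18 F by (simp add: m_def)
    from runs_Seq[OF 1 runs_Seq[OF runs_skip_row runs_Seq[OF runs_move_mark[OF v] runs_shift[of Stay Stay GoRight]]]]
    have "runs ?b (?S v) (18 * (15 * m + 4) + 1 + (6 * m + 4 + (6 * m + 6 + 1)))
      (conf xs (int (length pre + v * m) + int m + 0) ((ys @ concat (map F [0..<v])) @ F v) (unit_bits m (Suc v)) (0 + 0)
        (replicate m True) (int v + 1))"
      by simp
    moreover have "int (length pre + v * m) + int m + 0 = int (length pre + Suc v * m)"
      "(ys @ concat (map F [0..<v])) @ F v = ys @ concat (map F [0..<Suc v])"
      "(0 :: int) + 0 = 0" "int v + 1 = int (Suc v)" by simp_all
    ultimately have "runs ?b (?S v) (18 * (15 * m + 4) + 1 + (6 * m + 4 + (6 * m + 6 + 1))) (?S (Suc v))"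
      by (simp only:)
    then show "runs ?b (?S v) (282 * m + 84) (?S (Suc v))"
      by (rule runs_mono) simp
  next
    show "\<not> map head_symbol (?S m) ! 3 \<noteq> 0"
      using string_contents_blank(1)[of "replicate m True"] by (simp add: heads_conf)
  qed
  then show ?thesis by (simp add: numeral_eq_Suc)
qed

lemma runs_emit_incidence_matrix:
  fixes G :: graph
  defines "m \<equiv> fst G"
  assumes xs: "xs = pre @ encode_graph G @ post"
  shows "runs emit_incidence_matrix
     (conf xs (int (length pre)) ys (replicate m False) 0 (replicate m True) 0) (400 * (m + 1) * (m + 1))
     (conf xs (int (length pre + length (encode_graph G))) (ys @ encode_mat (incidence_matrix G))
       (replicate m False) 0 (replicate m True) 0)"
proof -
  let ?i = "int (length pre)" and ?U = "replicate m False" and ?R = "replicate m True"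
  let ?pre = "pre @ replicate m True @ [False]"
  define F where "F v = matrix_bits (concat (map (incidence_column G v) column_shapes))" for v
  have xs': "xs = ?pre @ concat (map (adjacency_row G) [0..<m]) @ post"
    using xs by (simp add: encode_graph_eq m_def)
  have head: "string_contents xs (?i + int t) = (if t < m then 2 else 1)" if "t \<le> m" for t
    using that xs' string_contents_nth[of "length pre + t" xs] by (simp add: nth_append)
  have "runs (While (\<lambda>ss. ss ! 0 = 2) (shift GoRight Stay Stay)) (conf xs ?i ys ?U 0 ?R 0) (3 * m + 1)
     (conf xs (?i + int m * offset GoRight) ys ?U (0 + int m * offset Stay) ?R (0 + int m * offset Stay))"
    using head by (intro runs_scan) auto
  then have 1: "runs (While (\<lambda>ss. ss ! 0 = 2) (shift GoRight Stay Stay)) (conf xs ?i ys ?U 0 ?R 0) (3 * m + 1)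
     (conf xs (?i + int m) ys ?U 0 ?R 0)" by simp
  have 2: "runs (shift GoRight Stay Stay) (conf xs (?i + int m) ys ?U 0 ?R 0) 1 (conf xs (int (length ?pre)) ys ?U 0 ?R 0)"
    using runs_shift[of GoRight Stay Stay xs "?i + int m" ys ?U 0 ?R 0] by (simp add: algebra_simps)
  let ?y1 = "ys @ concat (replicate m (replicate 3 True))"
  let ?y2 = "?y1 @ [False]"
  let ?y3 = "?y2 @ concat (replicate m (replicate 6 True))"
  let ?y4 = "?y3 @ [True, False]"
  let ?y5 = "?y4 @ concat (replicate m (matrix_bits (replicate 3 False)))"
  have len: "length ?U = m" "length ?R = m" by simp_all
  have 3: "runs mark (conf xs (int (length ?pre)) ?y5 ?U 0 ?R 0) 1 (conf xs (int (length ?pre)) ?y5 (unit_bits m 0) 0 ?R 0)"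
    using runs_mark[of 0 m] by simp
  have 4: "runs rewind_rows (conf xs i zs (unit_bits m m) 0 ?R (int m)) (3 * m + 3) (conf xs i zs (unit_bits m m) 0 ?R 0)" for i zs
    by (rule runs_rewind_rows) simp
  note runs_Seq[OF 1 runs_Seq[OF 2 runs_Seq[OF runs_emit_per_node[OF len(1)] runs_Seq[OF runs_emit
    runs_Seq[OF runs_emit_per_node[OF len(1)] runs_Seq[OF runs_emit runs_Seq[OF runs_emit_per_node[OF len(1)]
    runs_Seq[OF 3 runs_Seq[OF runs_columns_of_nodes[OF xs'[unfolded m_def], folded m_def] 4]]]]]]]]]
  then have *: "runs emit_incidence_matrix (conf xs ?i ys ?U 0 ?R 0)
     (3 * m + 1 + (1 + (m * (3 + 7) + 4 + (2 + (m * (6 + 7) + 4 + (3 + (m * (6 + 7) + 4 + (1 + (m * (282 * m + 86) + 1 + (3 * m + 3))))))))))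
     (conf xs (int (length ?pre + m * m)) (?y5 @ concat (map F [0..<m])) (unit_bits m m) 0 ?R 0)"
    unfolding emit_incidence_matrix_def F_def by (simp add: numeral_eq_Suc matrix_bits_def encode_int_def encode_nat_0)
  have "concat (replicate m (matrix_bits (replicate 3 False))) = matrix_bits (replicate (3 * m) False)"
    by (induction m) (simp_all add: matrix_bits_append replicate_add, simp add: matrix_bits_def)
  moreover have "concat (map F vs) = matrix_bits (concat (concat (map (\<lambda>v. map (incidence_column G v) column_shapes) vs)))" for vs
    by (induction vs) (simp_all add: F_def matrix_bits_append, simp add: matrix_bits_def)
  ultimately have out: "?y5 @ concat (map F [0..<m]) = ys @ encode_mat (incidence_matrix G)"
    by (simp add: encode_incidence_matrix concat_replicate_replicate incidence_columns_def matrix_bits_append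
        m_def replicate_append_same replicate_add)
  have pos: "length ?pre + m * m = length pre + length (encode_graph G)"
    by (simp add: length_encode_graph m_def)
  show ?thesis
    using * unfolding out pos unit_bits_past by (rule runs_mono) (simp add: algebra_simps)
qed

text \<open>Copies the unary number of nodes of the first graph to the two auxiliary tapes.\<close>

definition read_node_count :: prog where
  "read_node_count =
     While (\<lambda>ss. ss ! 0 = 2) (Basic [go GoRight, go Stay, put False, put True]) ;;
     shift GoRight Stay Stay ;; rewind_units Stay Stay ;; rewind_rows"

lemma runs_read_node_count:
  assumes xs: "xs = replicate m True @ False # post"
  shows "runs read_node_count (conf xs 0 ys [] 0 [] 0) (9 * m + 8)
    (conf xs (int (m + 1)) ys (replicate m False) 0 (replicate m True) 0)"
proof -
  let ?S = "\<lambda>t. conf xs (int t) ys (replicate t False) (int t) (replicate t True) (int t)"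
  have head: "string_contents xs (int t) = (if t < m then 2 else 1)" if "t \<le> m" for t
    using that xs string_contents_nth[of t xs] by (simp add: nth_append)
  have "runs (While (\<lambda>ss. ss ! 0 = 2) (Basic [go GoRight, go Stay, put False, put True])) (?S 0) (m * (1 + 2) + 1) (?S m)"
  proof (rule runs_While)
    fix t assume "t < m"
    show "runs (Basic [go GoRight, go Stay, put False, put True]) (?S t) 1 (?S (Suc t))"
      using act_put[of False "replicate t False"] act_put[of True "replicate t True"]
      unfolding conf_def
      by (intro runs_Basic) (simp add: add.commute replicate_append_same del: act.simps head_symbol.simps)
  qed (use head in \<open>simp_all add: heads_conf\<close>)
  then have 1: "runs (While (\<lambda>ss. ss ! 0 = 2) (Basic [go GoRight, go Stay, put False, put True]))
      (conf xs 0 ys [] 0 [] 0) (3 * m + 1) (?S m)"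
    by (simp, elim runs_mono) simp
  have 2: "runs (shift GoRight Stay Stay) (?S m) 1
      (conf xs (int (m + 1)) ys (replicate m False) (int m) (replicate m True) (int m))"
    using runs_shift[of GoRight Stay Stay xs "int m"] by (simp add: add.commute)
  have 3: "runs (rewind_units Stay Stay) (conf xs i ys (replicate m False) (int m) cs r) (3 * m + 3)
      (conf xs i ys (replicate m False) 0 cs r)" for i cs r
    using runs_rewind_units[of m "replicate m False" Stay Stay xs i] by simp
  have 4: "runs rewind_rows (conf xs i ys us 0 (replicate m True) (int m)) (3 * m + 3)
      (conf xs i ys us 0 (replicate m True) 0)" for i us
    by (rule runs_rewind_rows) simp
  from runs_Seq[OF 1 runs_Seq[OF 2 runs_Seq[OF 3 4]]]
  show ?thesis unfolding read_node_count_def by (rule runs_mono) simp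
qed

text \<open>Skips the adjacency matrix of the first graph.\<close>

definition skip_square :: prog where
  "skip_square = While (\<lambda>ss. ss ! 3 \<noteq> 0) (skip_row ;; shift Stay Stay GoRight) ;; rewind_rows"

lemma runs_skip_square:
  assumes "length us = m" "length cs = m"
  shows "runs skip_square (conf xs i ys us 0 cs 0) (m * (6 * m + 10) + 4)
     (conf xs (i + int (m * m)) ys us 0 cs 0)"
proof -
  let ?S = "\<lambda>t. conf xs (i + int (t * m)) ys us 0 cs (int t)"
  have "runs (While (\<lambda>ss. ss ! 3 \<noteq> 0) (skip_row ;; shift Stay Stay GoRight)) (?S 0)
     (m * (6 * m + 5 + 2) + 1) (?S m)"
  proof (rule runs_While)
    fix t assume t: "t < m"
    then show "map head_symbol (?S t) ! 3 \<noteq> 0"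
      using string_contents_nonblank[of t cs] assms(2) by (simp add: heads_conf)
    show "runs (skip_row ;; shift Stay Stay GoRight) (?S t) (6 * m + 5) (?S (Suc t))"
      using runs_Seq[OF runs_skip_row[OF assms(1)] runs_shift[of Stay Stay GoRight],
          of xs "i + int (t * m)" ys cs "int t"]
      by (simp add: algebra_simps)
  next
    show "\<not> map head_symbol (?S m) ! 3 \<noteq> 0"
      by (simp add: heads_conf flip: assms(2))
  qed
  then have "runs (While (\<lambda>ss. ss ! 3 \<noteq> 0) (skip_row ;; shift Stay Stay GoRight)) (conf xs i ys us 0 cs 0)
     (m * (6 * m + 7) + 1) (conf xs (i + int (m * m)) ys us 0 cs (int m))"
    by (simp add: numeral_eq_Suc)
  from runs_Seq[OF this runs_rewind_rows[of m cs]] assms(2)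
  show ?thesis unfolding skip_square_def by (auto elim: runs_mono simp: algebra_simps)
qed

definition compare_node_count :: prog where
  "compare_node_count = While (\<lambda>ss. ss ! 0 = 2 \<and> ss ! 2 \<noteq> 0) (shift GoRight GoRight Stay)"

text \<open>The scan stops at the end of the shorter of the two unary numbers. They are equal iff both ends have
  been reached, that is, iff the input shows the terminating bit \<open>False\<close> and the unit tape a blank.\<close>

lemma runs_compare_node_count:
  assumes xs: "xs = pre @ replicate m' True @ False # post" and us: "length us = m"
  shows "runs compare_node_count (conf xs (int (length pre)) ys us 0 cs r) (3 * m + 1)
    (conf xs (int (length pre + min m m')) ys us (int (min m m')) cs r)"
    and "string_contents xs (int (length pre + min m m')) = 1 \<and> string_contents us (int (min m m')) = 0
      \<longleftrightarrow> m = m'"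
proof -
  have head: "string_contents xs (int (length pre) + int t) = (if t < m' then 2 else 1)" if "t \<le> m'" for t
    using that xs string_contents_nth[of "length pre + t" xs] by (simp add: nth_append)
  have unit: "string_contents us (int t) = 0 \<longleftrightarrow> t = m" if "t \<le> m" for t
    using that us string_contents_nonblank[of t us] string_contents_blank(1)[of us]
    by (cases "t = m") simp_all
  have inside: "string_contents xs (int (length pre) + int t) = 2 \<and> string_contents us (int t) \<noteq> 0"
    if "t < min m m'" for t
    using that head[of t] unit[of t] by simp
  have outside: "\<not> (string_contents xs (int (length pre) + int (min m m')) = 2 \<and>
      string_contents us (int (min m m')) \<noteq> 0)"
    using head[of "min m m'"] unit[of "min m m'"] by (cases "m \<le> m'") simp_all
  have "runs compare_node_count (conf xs (int (length pre)) ys us 0 cs r) (3 * min m m' + 1)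
    (conf xs (int (length pre) + int (min m m') * offset GoRight) ys us (0 + int (min m m') * offset GoRight)
      cs (r + int (min m m') * offset Stay))"
    unfolding compare_node_count_def
    using inside outside by (intro runs_scan) (simp_all del: of_nat_min)
  then show "runs compare_node_count (conf xs (int (length pre)) ys us 0 cs r) (3 * m + 1)
    (conf xs (int (length pre + min m m')) ys us (int (min m m')) cs r)"
    by (simp del: of_nat_min, elim runs_mono) simp
  show "string_contents xs (int (length pre + min m m')) = 1 \<and> string_contents us (int (min m m')) = 0
      \<longleftrightarrow> m = m'"
    using head[of "min m m'"] unit[of "min m m'"] by (auto simp: min_def split: if_splits)
qed

text \<open>The string \<open>bs\<close> is the output for graphs with different numbers of nodes.\<close>

definition reduction_program :: "bool list \<Rightarrow> prog" where
  "reduction_program bs =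
     read_node_count ;; skip_square ;; compare_node_count ;;
     Cond (\<lambda>ss. ss ! 0 = 1 \<and> ss ! 2 = 0)
       (rewind_units Stay Stay ;; rewind_input ;; emit_incidence_matrix ;; emit_incidence_matrix)
       (emit bs)"

lemma tape_ops_within_reduction_program: "tape_ops_within 4 3 (reduction_program bs)"
proof -
  have [simp]: "tape_ops_within 4 3 (shift d d' d'')" for d d' d''
    by (simp add: shift_def go_def)
  have [simp]: "tape_ops_within 4 3 (emit bs)" for bs
    by (induction bs) (auto simp: go_def put_def)
  have [simp]: "tape_ops_within 4 3 (emit_blocks qs)" for qs
    by (induction qs) (simp_all add: emit_block_def rewind_units_def del: emit.simps)
  show ?thesis
    by (simp add: reduction_program_def read_node_count_def skip_square_def compare_node_count_def
        rewind_units_def rewind_input_def rewind_rows_def emit_incidence_matrix_def emit_per_node_def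
        skip_row_def move_mark_def mark_def go_def put_def del: emit.simps)
qed

text \<open>The input contains the adjacency matrices, so its length bounds \<open>m\<^sup>2\<close>, which is the order of the
  number of entries of the output; each entry takes a bounded number of steps.\<close>

lemma computes_within_reduction_program:
  fixes G G' :: graph and bs :: "bool list"
  defines "xs \<equiv> encode_graph G @ encode_graph G'"
  shows "computes_within 4 (code (reduction_program bs) 0)
     (900 * (length xs + 1) * (length xs + 1) + length bs) xs
     (if fst G = fst G' then encode_mat (incidence_matrix G) @ encode_mat (incidence_matrix G') else bs)"
proof -
  define m m' where "m = fst G" and "m' = fst G'"
  define L where "L = length xs"
  let ?U = "replicate m False" and ?R = "replicate m True"
  let ?e = "min m m'"
  have start: "snd (initial_config 4 xs) = conf xs 0 [] [] 0 [] 0"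
    by (simp add: initial_config_def conf_def string_contents_def[abs_def] numeral_eq_Suc fun_eq_iff)
  have xs1: "xs = replicate m True @ False # (concat (map (adjacency_row G) [0..<m]) @ encode_graph G')"
    and xs2: "xs = encode_graph G @ replicate m' True @ False # concat (map (adjacency_row G') [0..<m'])"
    by (simp_all add: xs_def encode_graph_eq m_def m'_def)
  have L: "L = m + 1 + m * m + (m' + 1 + m' * m')"
    by (simp add: L_def xs_def length_encode_graph m_def m'_def)
  have 1: "runs read_node_count (conf xs 0 [] [] 0 [] 0) (9 * m + 8) (conf xs (int (m + 1)) [] ?U 0 ?R 0)"
    by (rule runs_read_node_count[OF xs1])
  have "int (m + 1) + int (m * m) = int (length (encode_graph G))"
    by (simp add: length_encode_graph m_def)
  with runs_skip_square[of ?U m ?R xs "int (m + 1)" "[]"]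
  have 2: "runs skip_square (conf xs (int (m + 1)) [] ?U 0 ?R 0) (m * (6 * m + 10) + 4)
     (conf xs (int (length (encode_graph G))) [] ?U 0 ?R 0)"
    by simp
  note 3 = runs_compare_node_count[OF xs2, of ?U m, simplified length_replicate, OF refl]
  let ?s = "conf xs (int (length (encode_graph G) + ?e)) [] ?U (int ?e) ?R 0"
  let ?out = "if m = m' then encode_mat (incidence_matrix G) @ encode_mat (incidence_matrix G') else bs"
  have le: "length (encode_graph G) + ?e \<le> L"
    using L by (simp add: length_encode_graph m_def)
  have mm: "m \<le> L" "m * m \<le> L" using L by simp_all
  have "\<exists>ts. runs (Cond (\<lambda>ss. ss ! 0 = 1 \<and> ss ! 2 = 0)
       (rewind_units Stay Stay ;; rewind_input ;; emit_incidence_matrix ;; emit_incidence_matrix)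
       (emit bs)) ?s (3 * m + 3 + (3 * L + 3 + (400 * (m + 1) * (m + 1) + 400 * (m + 1) * (m + 1))) + 2 + length bs) ts
     \<and> fst (ts ! 1) = string_contents ?out"
  proof (cases "m = m'")
    case True
    then have e: "?e = m" by simp
    have 4: "runs (rewind_units Stay Stay) ?s (3 * m + 3) (conf xs (int (length (encode_graph G) + ?e)) [] ?U 0 ?R 0)"
      using runs_rewind_units[of m ?U Stay Stay xs] by (simp add: e)
    have 5: "runs rewind_input (conf xs (int (length (encode_graph G) + ?e)) [] ?U 0 ?R 0) (3 * L + 3)
       (conf xs 0 [] ?U 0 ?R 0)"
      using le by (intro runs_mono[OF runs_rewind_input]) (simp_all add: L_def)
    have 6: "runs emit_incidence_matrix (conf xs 0 [] ?U 0 ?R 0) (400 * (m + 1) * (m + 1))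
       (conf xs (int (length (encode_graph G))) (encode_mat (incidence_matrix G)) ?U 0 ?R 0)"
      using runs_emit_incidence_matrix[of xs "[]" G "encode_graph G'" "[]"]
      by (simp add: xs_def m_def)
    have 7: "runs emit_incidence_matrix
       (conf xs (int (length (encode_graph G))) (encode_mat (incidence_matrix G)) ?U 0 ?R 0) (400 * (m + 1) * (m + 1))
       (conf xs (int (length (encode_graph G) + length (encode_graph G')))
         (encode_mat (incidence_matrix G) @ encode_mat (incidence_matrix G')) ?U 0 ?R 0)"
      using runs_emit_incidence_matrix[of xs "encode_graph G" G' "[]" "encode_mat (incidence_matrix G)"] True
      by (simp add: xs_def m_def m'_def)
    have "(\<lambda>ss. ss ! 0 = 1 \<and> ss ! 2 = 0) (map head_symbol ?s)"
      using 3(2) True by (simp add: heads_conf)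
    from runs_Cond_True[of "\<lambda>ss. ss ! 0 = 1 \<and> ss ! 2 = 0", OF this runs_Seq[OF 4 runs_Seq[OF 5 runs_Seq[OF 6 7]]], of "emit bs"]
    show ?thesis
      by (intro exI conjI) (erule runs_mono, simp, simp add: conf_def True)
  next
    case False
    then have "\<not> (\<lambda>ss. ss ! 0 = 1 \<and> ss ! 2 = 0) (map head_symbol ?s)"
      using 3(2) by (simp add: heads_conf)
    note run = runs_Cond_False[of "\<lambda>ss. ss ! 0 = 1 \<and> ss ! 2 = 0", OF this runs_emit[of bs]]
    show ?thesis
      by (intro exI conjI) (rule runs_mono[OF run], simp, simp add: conf_def False)
  qed
  then obtain ts where 8: "runs (Cond (\<lambda>ss. ss ! 0 = 1 \<and> ss ! 2 = 0)
       (rewind_units Stay Stay ;; rewind_input ;; emit_incidence_matrix ;; emit_incidence_matrix)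
       (emit bs)) ?s (3 * m + 3 + (3 * L + 3 + (400 * (m + 1) * (m + 1) + 400 * (m + 1) * (m + 1))) + 2 + length bs) ts"
    and ts: "fst (ts ! 1) = string_contents ?out" by blast
  note run = runs_Seq[OF 1 runs_Seq[OF 2 runs_Seq[OF 3(1) 8]], folded reduction_program_def]
  have "9 * m + 8 + (m * (6 * m + 10) + 4 + (3 * m + 1 + (3 * m + 3 + (3 * L + 3 +
      (400 * (m + 1) * (m + 1) + 400 * (m + 1) * (m + 1))) + 2 + length bs)))
      = 806 * (m * m) + 1625 * m + 3 * L + 821 + length bs"
    by (simp add: algebra_simps)
  also have "\<dots> \<le> 900 * (L + 1) * (L + 1) + length bs"
  proof -
    have "900 * (L + 1) * (L + 1) = 900 * (L * L) + 1800 * L + 900" by (simp add: algebra_simps)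
    with mm le_square[of L] show ?thesis by linarith
  qed
  finally show ?thesis
    unfolding L_def[symmetric] m_def[symmetric] m'_def[symmetric]
    by (rule computes_within_code[OF run[folded start] ts])
qed

section \<open>The reduction\<close>

text \<open>A graph isomorphism permutes the coordinates within each of the three blocks; the hyperedge
  \<open>(v, c)\<close> goes to \<open>(\<phi> v, c)\<close>.\<close>

lemma unimodular_isomorphic_incidence:
  assumes iso: "graph_isomorphic G G'"
    and G: "simple_graph G" "simple_graph G'" and eq: "fst G = fst G'"
  shows "unimodular_isomorphic (3 * fst G) (polytope_of (incidence_matrix G)) (polytope_of (incidence_matrix G'))"
proof -
  define m where "m = fst G"
  have m': "fst G' = m" using eq by (simp add: m_def)
  obtain \<phi> where \<phi>: "bij_betw \<phi> {..<m} {..<m}"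
    and adj: "\<And>v w. v < m \<Longrightarrow> w < m \<Longrightarrow> {\<phi> v, \<phi> w} \<in> edges G' \<longleftrightarrow> {v, w} \<in> edges G"
    using iso m' unfolding graph_isomorphic_def nodes_def m_def by auto
  then have \<phi>_less: "\<phi> v < m" if "v < m" for v using that by (auto simp: bij_betw_def)
  have \<phi>_inj: "\<phi> v = \<phi> w \<longleftrightarrow> v = w" if "v < m" "w < m" for v w
    using \<phi> that by (auto simp: bij_betw_def inj_on_eq_iff)
  \<comment> \<open>the coordinate \<open>(b, v)\<close> goes to \<open>(b, \<phi> v)\<close>\<close>
  define \<pi> where "\<pi> i = (i div m) * m + \<phi> (i mod m)" for i
  have \<pi>_block: "\<pi> (b * m + v) = b * m + \<phi> v" if "b < 3" "v < m" for b v
    using block_index[OF that(2,1)] by (simp add: \<pi>_def)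
  have inj: "inj_on \<pi> {..<3 * m}"
  proof (rule inj_onI)
    fix i j assume "i \<in> {..<3 * m}" "j \<in> {..<3 * m}" and eq: "\<pi> i = \<pi> j"
    then obtain b v c w where i: "b < 3" "v < m" "i = b * m + v" and j: "c < 3" "w < m" "j = c * m + w"
      by (auto elim!: block_indexE)
    then have "b * m + \<phi> v = c * m + \<phi> w" using eq \<pi>_block by simp
    then have "b = c" "\<phi> v = \<phi> w"
      using block_index[OF \<phi>_less[OF i(2)] i(1)] block_index[OF \<phi>_less[OF j(2)] j(1)] by metis+
    then show "i = j" using i j \<phi>_inj by simp
  qed
  have "\<pi> ` {..<3 * m} \<subseteq> {..<3 * m}"
    using \<pi>_block block_index(1) \<phi>_less by (auto elim!: block_indexE)
  with inj have bij: "bij_betw \<pi> {..<3 * m} {..<3 * m}"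
    using endo_inj_surj[of "{..<3 * m}" \<pi>] by (simp add: bij_betw_def)
  have edge: "\<pi> ` hyperedge G v c = hyperedge G' (\<phi> v) c" if v: "v < m" for v c
  proof -
    have mem: "\<pi> i \<in> hyperedge G' (\<phi> v) c \<longleftrightarrow> i \<in> hyperedge G v c" if "i < 3 * m" for i
    proof -
      from that obtain b u where b: "b < 3" "u < m" "i = b * m + u" by (rule block_indexE)
      show ?thesis
        using in_hyperedge[of u G b v c] in_hyperedge[of "\<phi> u" G' b "\<phi> v" c] b v \<phi>_less \<phi>_inj adj \<pi>_block
        by (simp add: m' flip: m_def)
    qed
    have "hyperedge G v c \<subseteq> {..<3 * m}" "hyperedge G' (\<phi> v) c \<subseteq> {..<3 * m}"
      by (auto simp: hyperedge_def m_def m'[unfolded m_def])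
    moreover have "\<pi> ` {..<3 * m} = {..<3 * m}" using bij by (simp add: bij_betw_def)
    ultimately show ?thesis
    proof (intro antisym subsetI)
      fix x assume sub: "hyperedge G v c \<subseteq> {..<3 * m}" and "x \<in> \<pi> ` hyperedge G v c"
      then obtain i where "i \<in> hyperedge G v c" "x = \<pi> i" by blast
      then show "x \<in> hyperedge G' (\<phi> v) c" using mem[of i] sub by auto
    next
      fix x assume x: "x \<in> hyperedge G' (\<phi> v) c"
        and "hyperedge G' (\<phi> v) c \<subseteq> {..<3 * m}" "\<pi> ` {..<3 * m} = {..<3 * m}"
      then have "x \<in> \<pi> ` {..<3 * m}" by auto
      then obtain i where "i < 3 * m" "x = \<pi> i" by auto
      then show "x \<in> \<pi> ` hyperedge G v c" using mem[of i] x by blast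
    qed
  qed
  have "(\<lambda>h. \<pi> ` h) ` incidence_hypergraph G = (\<Union>v<m. hyperedges_at G' (\<phi> v))"
    using edge by (auto simp: incidence_hypergraph_def hyperedges_at_def image_UN image_image m_def)
  also have "\<dots> = (\<Union>v\<in>\<phi> ` {..<m}. hyperedges_at G' v)" by auto
  also have "\<dots> = incidence_hypergraph G'"
    using \<phi> by (simp add: bij_betw_def incidence_hypergraph_def m')
  finally have "(\<lambda>h. \<pi> ` h) ` incidence_hypergraph G = incidence_hypergraph G'" .
  with bij show ?thesis
    using unimodular_isomorphic_hypergraphI[OF hypergraph_incidence[of G] hypergraph_matrix_incidence[OF G(1)], of
        "incidence_hypergraph G'" "incidence_matrix G'" \<pi>] hypergraph_matrix_incidence[OF G(2)] eq
    by (simp add: m_def)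
qed

lemma unimodular_isomorphic_incidence_iff:
  assumes G: "simple_graph G" "simple_graph G'" and eq: "fst G = fst G'"
  shows "unimodular_isomorphic (3 * fst G) (polytope_of (incidence_matrix G)) (polytope_of (incidence_matrix G'))
    \<longleftrightarrow> graph_isomorphic G G'"
proof
  assume iso: "unimodular_isomorphic (3 * fst G) (polytope_of (incidence_matrix G)) (polytope_of (incidence_matrix G'))"
  have deg: "3 dvd card {h \<in> incidence_hypergraph K. i \<in> h} + 1" if "simple_graph K" "i < 3 * fst K" for K i
  proof -
    from that(2) obtain b u where b: "b < 3" "u < fst K" "i = b * fst K + u" by (rule block_indexE)
    let ?d = "card {v. v < fst K \<and> {v, u} \<in> edges K}"
    have "(if b = 0 then 3 * ?d else 0) + 2 + 1 = 3 * ((if b = 0 then ?d else 0) + 1)" by simp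
    then show ?thesis unfolding b(3) hyperedges_through[OF that(1) b(2,1)] by (metis dvd_triv_left)
  qed
  have cop: "coprime (6 * fst G + 1) (3 :: nat)"
  proof (rule coprimeI)
    fix d :: nat assume "d dvd 6 * fst G + 1" "d dvd 3"
    moreover from this have "d dvd 3 * (2 * fst G)" by (intro dvd_mult2)
    ultimately have "d dvd 6 * fst G + 1 - 3 * (2 * fst G)" by (intro dvd_diff_nat)
    then show "is_unit d" by simp
  qed
  obtain \<pi> where "bij_betw \<pi> {..<3 * fst G} {..<3 * fst G}"
    "(\<lambda>h. \<pi> ` h) ` incidence_hypergraph G = incidence_hypergraph G'"
    using unimodular_isomorphic_hypergraphD[OF hypergraph_incidence hypergraph_incidence[of G', folded eq]
        hypergraph_matrix_incidence[OF G(1)] hypergraph_matrix_incidence[OF G(2), folded eq], of 3] cop deg G eq iso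
    unfolding card_vertex_sets[OF G(1)] by auto
  then show "graph_isomorphic G G'" using graph_isomorphic_incidence[OF G] eq by simp
qed (rule unimodular_isomorphic_incidence[OF _ G eq])

lemma hypergraph_matrix_exists:
  assumes "hypergraph n H"
  obtains V where "hypergraph_matrix n H V"
proof -
  obtain cs where cs: "set cs = point n ` vertex_sets n H" "distinct cs"
    using finite_distinct_list[of "point n ` vertex_sets n H"] finite_vertex_sets[OF assms] by auto
  then have "cols (mat_of_cols n cs) = cs" by (intro cols_mat_of_cols) auto
  with cs show ?thesis by (intro that[of "mat_of_cols n cs"]) (simp add: hypergraph_matrix_def)
qed

text \<open>A triangle and a square: isomorphic polytopes have equally many vertices.\<close>

lemma non_isomorphic_instance:
  obtains V V' where "(V, V') \<in> instances UIP" "\<not> answer_yes UIP (V, V')"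
proof -
  have H: "hypergraph 2 {}" "hypergraph 2 {{0, 1}}" by (auto simp: hypergraph_def)
  obtain V V' where V: "hypergraph_matrix 2 {} V" "hypergraph_matrix 2 {{0, 1}} V'"
    using hypergraph_matrix_exists[OF H(1)] hypergraph_matrix_exists[OF H(2)] by metis
  have vm: "vertex_matrix V" "vertex_matrix V'"
    using vertex_matrix_hypergraph[OF H(1) V(1)] vertex_matrix_hypergraph[OF H(2) V(2)] by blast+
  have dim: "dim_row V = 2" "dim_row V' = 2" using V by (simp_all add: hypergraph_matrix_def)
  have card: "card (set (cols M)) = card (vertex_sets 2 K)" if "hypergraph 2 K" "hypergraph_matrix 2 K M" for K M
    using that vertex_sets_Pow[OF that(1)]
    by (simp add: hypergraph_matrix_def card_image inj_on_subset[OF inj_on_point])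
  have "vertex_sets 2 {} = {{}, {0}, {1}}" "vertex_sets 2 {{0, 1}} = {{}, {0}, {1}, {0, 1}}"
    by (auto simp: vertex_sets_def less_2_cases_iff)
  then have "card (set (cols V)) < card (set (cols V'))"
    using card[OF H(1) V(1)] card[OF H(2) V(2)] by (simp add: doubleton_eq_iff)
  then have "\<not> unimodular_isomorphic 2 (polytope_of V) (polytope_of V')"
    by (metis unimodular_isomorphic_columnsE[OF _ vm dim(1)] List.finite_set card_image_le not_le)
  with vm dim show ?thesis by (intro that[of V V']) (simp_all add: UIP_def)
qed

theorem theorem3p2:
  shows "karp_reducible GIP UIP"
proof -
  obtain V\<^sub>0 V\<^sub>0' where no: "(V\<^sub>0, V\<^sub>0') \<in> instances UIP" "\<not> answer_yes UIP (V\<^sub>0, V\<^sub>0')"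
    by (rule non_isomorphic_instance)
  define bs where "bs = encode UIP (V\<^sub>0, V\<^sub>0')"
  \<comment> \<open>the expanded time bound \<open>900 (n + 1)\<^sup>2 + length bs\<close>\<close>
  define p where "p = [:900 + length bs, 1800, 900:]"
  let ?M = "code (reduction_program bs) 0"
  have p: "poly p n = 900 * (n + 1) * (n + 1) + length bs" for n
    by (simp add: p_def algebra_simps)
  have "\<exists>J\<in>instances UIP. computes_within 4 ?M (poly p (length (encode GIP I))) (encode GIP I) (encode UIP J)
      \<and> (answer_yes UIP J \<longleftrightarrow> answer_yes GIP I)" if "I \<in> instances GIP" for I
  proof -
    obtain G G' where I: "I = (G, G')" by (cases I) blast
    then have G: "simple_graph G" "simple_graph G'" using that by (simp_all add: GIP_def)
    have enc: "encode GIP I = encode_graph G @ encode_graph G'" by (simp add: GIP_def I)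
    have yes: "answer_yes GIP I \<longleftrightarrow> graph_isomorphic G G'" by (simp add: GIP_def I)
    note run = computes_within_reduction_program[of bs G G', folded enc, folded p]
    show ?thesis
    proof (cases "fst G = fst G'")
      case True
      have "vertex_matrix (incidence_matrix G)" "vertex_matrix (incidence_matrix G')"
        using vertex_matrix_hypergraph[OF hypergraph_incidence hypergraph_matrix_incidence] G by blast+
      then have "(incidence_matrix G, incidence_matrix G') \<in> instances UIP"
        using True by (simp add: UIP_def incidence_matrix_def)
      moreover have "answer_yes UIP (incidence_matrix G, incidence_matrix G') \<longleftrightarrow> answer_yes GIP I"
        using unimodular_isomorphic_incidence_iff[OF G True]
        by (simp add: UIP_def yes) (simp add: incidence_matrix_def)
      moreover have "encode UIP (incidence_matrix G, incidence_matrix G')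
          = encode_mat (incidence_matrix G) @ encode_mat (incidence_matrix G')" by (simp add: UIP_def)
      ultimately show ?thesis
        using run True by (intro bexI[of _ "(incidence_matrix G, incidence_matrix G')"]) simp_all
    next
      case False
      have "\<not> graph_isomorphic G G'"
      proof
        assume "graph_isomorphic G G'"
        then obtain \<phi> where "bij_betw \<phi> {..<fst G} {..<fst G'}"
          by (auto simp: graph_isomorphic_def nodes_def)
        then show False using bij_betw_same_card False by fastforce
      qed
      then show ?thesis using run False no yes by (intro bexI[of _ "(V\<^sub>0, V\<^sub>0')"]) (simp_all add: bs_def)
    qed
  qed
  moreover have "turing_machine 4 3 ?M"
    using tape_ops_within_reduction_program by (intro turing_machine_code) simp_all
  ultimately have "turing_machine 4 3 ?M \<and> (\<forall>I\<in>instances GIP. \<exists>J\<in>instances UIP.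
      computes_within 4 ?M (poly p (length (encode GIP I))) (encode GIP I) (encode UIP J) \<and>
      (answer_yes UIP J \<longleftrightarrow> answer_yes GIP I))"
    by blast
  then show ?thesis
    unfolding karp_reducible_def by (intro exI)
qed

end
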